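(* For every $a>0$, $c>0$, $\mu\ge 0$, $\sigma>0$, $b>0$, $k>0$, $\lambda>0$ there exist constants $\omega, G, \gamma>0$ such that the following holds. Let $f\in C^0(\mathbb{R}_+;L^2(0,1))\cap C^0((0,+\infty)\times(0,1))$ be an arbitrary input, and let $u\in C^2(\mathbb{R}_+\times[0,1])$ and $\theta\in C^0(\mathbb{R}_+\times[0,1])\cap C^1((0,+\infty);L^2(0,1))$, with $u_{xx}\in C^1((0,+\infty);L^2(0,1))$ and $\theta[t],u_t[t]\in H^2(0,1)$ for all $t>0$, be any solution of $$u_{tt}(t,x)=c^2u_{xx}(t,x)+\sigma u_{xxt}(t,x)-\mu u_t(t,x)-b\,\theta_x(t,x)+f(t,x),\quad t>0,\ x\in(0,1),$$ $$\theta_t(t,x)=k\,\theta_{xx}(t,x)-\lambda u_{xt}(t,x),\quad t>0,\ x\in(0,1),$$ $$u(t,0)=0,\quad t>0,$$ $$u_x(t,1)=-a\,u_t(t,1),\quad t>0,$$ $$\theta(t,0)=\theta(t,1)=0,\quad t>0.$$ Then for all $t\ge 0$, $$\left(\|u_t[t]\|_2^2+\|u_x[t]\|_2^2+\|u_{xx}[t]\|_2^2+|u_t(t,1)|^2+\|\theta[t]\|_2^2\right)^{1/2}$$ $$\le G\exp(-\omega t)\left(\|u_t[0]\|_2^2+\|u_x[0]\|_2^2+\|u_{xx}[0]\|_2^2+|u_t(0,1)|^2+\|\theta[0]\|_2^2\right)^{1/2}+\gamma\sup_{0\le s\le t}\left(\|f[s]\|_2\right).$$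
   Context: $\mathbb{R}_+=[0,+\infty)$. All functions are real-valued. For an open set $S\subseteq\mathbb{R}^n$ and a set $A$ with $S\subseteq A\subseteq \mathrm{cl}(S)$, $C^0(A)$ is the class of continuous functions on $A$, and $C^k(A)$ ($k\ge1$) is the class of functions on $A$ that have continuous derivatives up to order $k$ in $S=\mathrm{int}(A)$ which can be continued continuously to all points of $\partial S\cap A$ (the values of derivatives at such points are these continuous extensions). For an interval $I$ and a normed space $Y$, $C^0(I;Y)$ (resp. $C^1(I;Y)$) is the class of continuous (resp. continuously differentiable) functions $I\to Y$. For a function $w$ of $(t,x)$, $w[t]$ denotes the profile $x\mapsto w(t,x)$, $x\in[0,1]$; subscripts $t,x$ denote partial derivatives. $H^2(0,1)$ is the Sobolev space of functions in $L^2(0,1)$ with all weak derivatives up to order $2$ in $L^2(0,1)$. $\|\cdot\|_2$ is the norm of $L^2(0,1)$: $\|v\|_2=\left(\int_0^1|v(x)|^2dx\right)^{1/2}$. For each $t>0$, $\theta_t[t]\in L^2(0,1)$ is the derivative of the $L^2(0,1)$-valued map $t\mapsto\theta[t]$; $\theta_x[t],\theta_{xx}[t]$ are the weak derivatives of $\theta[t]\in H^2(0,1)$; $u_{xxt}[t]\in L^2(0,1)$ is the derivative of the $L^2(0,1)$-valued map $t\mapsto u_{xx}[t]$ (which is also the weak second $x$-derivative of $u_t[t]\in H^2(0,1)$); and the two differential equations are understood for almost every $x\in(0,1)$. The constants $\omega,G,\gamma$ depend only on $a,c,\mu,\sigma,b,k,\lambda$ and not on $u,\theta,f$. *)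

theory Defs
  imports "HOL-Analysis.Analysis"
begin

text \<open>Partial derivative in direction \<open>e\<close> of a function on \<open>A\<close>: the usual derivative in the interior
  of \<open>A\<close>, and its continuous extension at the boundary points that belong to \<open>A\<close>.\<close>

definition partial_ext :: "'a::euclidean_space set \<Rightarrow> 'a \<Rightarrow> ('a \<Rightarrow> real) \<Rightarrow> 'a \<Rightarrow> real" where
  "partial_ext A e f x =
     (if x \<in> interior A then deriv (\<lambda>h. f (x + h *\<^sub>R e)) 0
      else Lim (at x within interior A) (\<lambda>y. deriv (\<lambda>h. f (y + h *\<^sub>R e)) 0))"

text \<open>The class $C^n(A)$, meant for \<open>A\<close> between an open set and its closure. Continuity of
  \<open>partial_ext A e f\<close> on \<open>A\<close> forces the limits at the boundary points of \<open>A\<close> to exist, so it says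
  exactly that the derivative extends continuously to \<open>A\<close>.\<close>

primrec C_class :: "nat \<Rightarrow> 'a::euclidean_space set \<Rightarrow> ('a \<Rightarrow> real) set" where
  "C_class 0 A = {f. continuous_on A f}"
| "C_class (Suc n) A = {f. continuous_on A f \<and>
     (\<forall>e\<in>Basis. (\<forall>x\<in>interior A. (\<lambda>h. f (x + h *\<^sub>R e)) differentiable (at 0)) \<and>
                partial_ext A e f \<in> C_class n A)}"

text \<open>Functions of \<open>(t, x)\<close> on \<open>strip\<close>; the profile of \<open>w\<close> at time \<open>t\<close> is \<open>curry w t\<close>.\<close>

definition strip :: "(real \<times> real) set" where
  "strip = {0..} \<times> {0..1}"

abbreviation dt :: "(real \<times> real \<Rightarrow> real) \<Rightarrow> real \<times> real \<Rightarrow> real" where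
  "dt \<equiv> partial_ext strip (1, 0)"

abbreviation dx :: "(real \<times> real \<Rightarrow> real) \<Rightarrow> real \<times> real \<Rightarrow> real" where
  "dx \<equiv> partial_ext strip (0, 1)"

abbreviation unit_measure :: "real measure" where
  "unit_measure \<equiv> lebesgue_on {0<..<1}"

text \<open>Elements of $L^2(0,1)$ are represented by functions; two functions represent the same element
  if they agree almost everywhere on $(0,1)$.\<close>

definition L2 :: "(real \<Rightarrow> real) set" where
  "L2 = {v \<in> borel_measurable unit_measure. integrable unit_measure (\<lambda>x. (v x)\<^sup>2)}"

definition L2_norm :: "(real \<Rightarrow> real) \<Rightarrow> real" where
  "L2_norm v = sqrt (LINT x|unit_measure. (v x)\<^sup>2)"

definition C0_L2 :: "real set \<Rightarrow> (real \<Rightarrow> real \<Rightarrow> real) set" where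
  "C0_L2 I = {w. (\<forall>t\<in>I. w t \<in> L2) \<and>
     (\<forall>t\<in>I. ((\<lambda>s. L2_norm (\<lambda>x. w s x - w t x)) \<longlongrightarrow> 0) (at t within I))}"

definition has_L2_derivative :: "(real \<Rightarrow> real \<Rightarrow> real) \<Rightarrow> (real \<Rightarrow> real) \<Rightarrow> real \<Rightarrow> bool" where
  "has_L2_derivative w v t \<longleftrightarrow> v \<in> L2 \<and>
     ((\<lambda>s. L2_norm (\<lambda>x. (w s x - w t x) / (s - t) - v x)) \<longlongrightarrow> 0) (at t)"

text \<open>A representative; it is unique up to null sets. Similarly for \<open>weak_deriv\<close> below.\<close>

definition L2_deriv :: "(real \<Rightarrow> real \<Rightarrow> real) \<Rightarrow> real \<Rightarrow> real \<Rightarrow> real" where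
  "L2_deriv w t = (SOME v. has_L2_derivative w v t)"

text \<open>For an open interval \<open>I\<close> (the derivative is two-sided).\<close>

definition C1_L2 :: "real set \<Rightarrow> (real \<Rightarrow> real \<Rightarrow> real) set" where
  "C1_L2 I = {w. (\<forall>t\<in>I. w t \<in> L2) \<and> (\<forall>t\<in>I. \<exists>v. has_L2_derivative w v t) \<and>
     L2_deriv w \<in> C0_L2 I}"

text \<open>Smooth functions with compact support in $(0,1)$.\<close>

definition test_function :: "(real \<Rightarrow> real) \<Rightarrow> bool" where
  "test_function \<phi> \<longleftrightarrow> (\<forall>n x. (deriv ^^ n) \<phi> differentiable (at x)) \<and>
     (\<exists>p q. 0 < p \<and> q < 1 \<and> (\<forall>x. x \<notin> {p..q} \<longrightarrow> \<phi> x = 0))"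

definition has_weak_derivative :: "nat \<Rightarrow> (real \<Rightarrow> real) \<Rightarrow> (real \<Rightarrow> real) \<Rightarrow> bool" where
  "has_weak_derivative n v w \<longleftrightarrow> v \<in> L2 \<and> w \<in> L2 \<and>
     (\<forall>\<phi>. test_function \<phi> \<longrightarrow>
        (LINT x|unit_measure. v x * (deriv ^^ n) \<phi> x) = (-1) ^ n * (LINT x|unit_measure. w x * \<phi> x))"

definition weak_deriv :: "nat \<Rightarrow> (real \<Rightarrow> real) \<Rightarrow> real \<Rightarrow> real" where
  "weak_deriv n v = (SOME w. has_weak_derivative n v w)"

definition H2 :: "(real \<Rightarrow> real) set" where
  "H2 = {v \<in> L2. \<forall>n\<in>{1, 2}. \<exists>w. has_weak_derivative n v w}"

definition state_norm :: "(real \<times> real \<Rightarrow> real) \<Rightarrow> (real \<times> real \<Rightarrow> real) \<Rightarrow> real \<Rightarrow> real" where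
  "state_norm u \<theta> t =
     sqrt ((L2_norm (curry (dt u) t))\<^sup>2 + (L2_norm (curry (dx u) t))\<^sup>2
         + (L2_norm (curry (dx (dx u)) t))\<^sup>2 + \<bar>dt u (t, 1)\<bar>\<^sup>2 + (L2_norm (curry \<theta> t))\<^sup>2)"

end

theory Submission
  imports Defs
begin

text \<open>The stability estimate comes from the Lyapunov functional
  \[ V = 1/2 |u_t|^2 + c^2/2 |u_x|^2 + a\<sigma>/2 u_t(t,1)^2 + b/(2 lam) |\<theta>|^2
       + \<epsilon>/2 |u_t - \<sigma> u_{xx}|^2, \]
  where $|.|$ is the norm of $L^2(0,1)$ and $\<epsilon>$ is small.

  The first four terms are the physical energy and a boundary correction to it. Testing the wave equation with $u_t$ and the heat
  equation with $\<theta>$ makes the coupling terms cancel. The Kelvin-Voigt term contributes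
  $\<sigma> u_t(t,1) u_{xt}(t,1) - \<sigma> |u_{xt}|^2$, and the damping condition $u_x = -a u_t$ at $x = 1$, differentiated
  in time, turns the boundary part into the time derivative of $-a\<sigma>/2 u_t(t,1)^2$, which is why this
  term is part of $V$. What remains dissipates $|u_{xt}|^2$, $|\<theta>_x|^2$ and $u_t(t,1)^2$, but does not
  control $u_x$ or $u_{xx}$.

  The last term repairs this. Since $u_{xxt}$ drops out of the time derivative of
  $w = u_t - \<sigma> u_{xx}$, one gets $w_t = c^2 u_{xx} - \<mu> u_t - b \<theta>_x + f$ with
  $c^2 u_{xx} = (c^2/\<sigma>)(u_t - w)$: an ordinary differential equation for $w$ with decay rate $c^2/\<sigma>$,
  forced by $u_t$, $\<theta>_x$ and $f$. The first two forcing terms are absorbed by the dissipation of the energy if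
  $\<epsilon>$ is small. As $\<sigma> u_{xx} = u_t - w$, and $u_x$ is recovered from $u_x(t,1) = -a u_t(t,1)$ and
  $u_{xx}$, all parts of the state are now dissipated, so that $V' \<le> -(m/M) V + K |f|^2$
  (lemma \<open>V_dissipation\<close>). Gronwall's lemma and the equivalence of $V$ with the square of the state norm
  (lemma \<open>state_norm_V_equivalent\<close>) finish the proof.

  The calculation must be justified for derivatives that exist only in $L^2(0,1)$ or weakly. In time,
  the squared norm of a curve that is differentiable in $L^2$ is differentiable by the product rule
  (lemma \<open>has_L2_derivative_norm_square\<close>), and the integration by parts of $u_{xxt}$ against $u_t$ is the
  time derivative of the classical integration by parts of $u_{xx}$ against a fixed profile
  (lemma \<open>ut_uxxt_by_parts\<close>). In space, the lemma of du Bois-Reymond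
  (lemma \<open>has_weak_derivative_1_primitive\<close>) shows that $\<theta>$ and $\<theta>_x$ are indefinite integrals of their
  weak derivatives. It rests on the existence of enough smooth functions with compact support, which
  are built from $exp(-1/x)$, and on an integration by parts for indefinite integrals
  (lemma \<open>integration_by_parts_L2\<close>).\<close>

section \<open>The inner product of $L^2(0,1)$\<close>

definition L2_inner :: "(real \<Rightarrow> real) \<Rightarrow> (real \<Rightarrow> real) \<Rightarrow> real" where
  "L2_inner f g = (LINT x|unit_measure. f x * g x)"

lemma L2_measurable [measurable_dest]: "f \<in> L2 \<Longrightarrow> f \<in> borel_measurable unit_measure"
  by (simp add: L2_def)

lemma L2_square_integrable: "f \<in> L2 \<Longrightarrow> integrable unit_measure (\<lambda>x. (f x)\<^sup>2)"
  by (simp add: L2_def)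

lemma L2_mult_integrable:
  assumes f: "f \<in> L2" and g: "g \<in> L2"
  shows "integrable unit_measure (\<lambda>x. f x * g x)"
proof (rule Bochner_Integration.integrable_bound)
  show "integrable unit_measure (\<lambda>x. (f x)\<^sup>2 + (g x)\<^sup>2)"
    using L2_square_integrable[OF f] L2_square_integrable[OF g] by simp
  show "(\<lambda>x. f x * g x) \<in> borel_measurable unit_measure"
    using f g by measurable
  have "\<bar>f x * g x\<bar> \<le> (f x)\<^sup>2 + (g x)\<^sup>2" for x
    using sum_squares_bound[of "\<bar>f x\<bar>" "\<bar>g x\<bar>"] abs_ge_zero[of "f x * g x"] unfolding abs_mult power2_abs by linarith
  then show "AE x in unit_measure. norm (f x * g x) \<le> norm ((f x)\<^sup>2 + (g x)\<^sup>2)"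
    by simp
qed

lemma L2_cmult: "f \<in> L2 \<Longrightarrow> (\<lambda>x. r * f x) \<in> L2"
  by (auto simp: L2_def power_mult_distrib)

lemma L2_add:
  assumes f: "f \<in> L2" and g: "g \<in> L2"
  shows "(\<lambda>x. f x + g x) \<in> L2"
proof -
  have "integrable unit_measure (\<lambda>x. (f x)\<^sup>2 + (g x)\<^sup>2 + 2 * (f x * g x))"
    using L2_square_integrable[OF f] L2_square_integrable[OF g] L2_mult_integrable[OF f g] by simp
  moreover have "(\<lambda>x. f x + g x) \<in> borel_measurable unit_measure"
    using f g by measurable
  ultimately show ?thesis
    by (simp add: L2_def power2_sum algebra_simps)
qed

lemma L2_minus: "f \<in> L2 \<Longrightarrow> (\<lambda>x. - f x) \<in> L2"
  using L2_cmult[of f "-1"] by simp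

lemma L2_diff: "f \<in> L2 \<Longrightarrow> g \<in> L2 \<Longrightarrow> (\<lambda>x. f x - g x) \<in> L2"
  using L2_add[of f "\<lambda>x. - g x"] L2_minus[of g] by simp

lemma L2_divide: "f \<in> L2 \<Longrightarrow> (\<lambda>x. f x / r) \<in> L2"
  using L2_cmult[of f "1 / r"] by simp

lemmas L2_intros = L2_cmult L2_add L2_minus L2_diff L2_divide

lemma integrable_unit_measure_continuous:
  assumes "continuous_on {0..1} (f :: real \<Rightarrow> real)"
  shows "integrable unit_measure f"
proof -
  have "f absolutely_integrable_on {0..1}"
    by (rule absolutely_integrable_continuous_real[OF assms])
  then have "f absolutely_integrable_on {0<..<1}"
    using absolutely_integrable_on_open_interval[where f = f and a = 0 and b = 1] by simp
  then show ?thesis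
    by (rule absolutely_integrable_imp_integrable) simp
qed

lemma LINT_unit_measure:
  fixes f :: "real \<Rightarrow> real"
  assumes "integrable unit_measure f"
  shows "(LINT x|unit_measure. f x) = integral {0..1} f"
  using lebesgue_integral_eq_integral[OF assms] integral_open_interval_real[of 0 1 f] by simp

lemma L2_continuous:
  assumes "continuous_on {0..1} f"
  shows "f \<in> L2"
  unfolding L2_def using assms
  by (auto intro!: borel_measurable_integrable integrable_unit_measure_continuous continuous_intros)

lemma L2_inner_continuous:
  assumes "continuous_on {0..1} f" "continuous_on {0..1} g"
  shows "L2_inner f g = integral {0..1} (\<lambda>x. f x * g x)"
  unfolding L2_inner_def
  by (intro LINT_unit_measure integrable_unit_measure_continuous continuous_intros assms)

lemma L2_integrable:
  assumes "f \<in> L2"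
  shows "integrable unit_measure f"
  using L2_mult_integrable[OF assms L2_continuous[of "\<lambda>_. 1"]] by simp

lemma L2_inner_commute: "L2_inner f g = L2_inner g f"
  by (simp add: L2_inner_def mult.commute)

lemma L2_inner_add_left:
  "\<lbrakk>f \<in> L2; g \<in> L2; h \<in> L2\<rbrakk> \<Longrightarrow> L2_inner (\<lambda>x. f x + g x) h = L2_inner f h + L2_inner g h"
  by (simp add: L2_inner_def distrib_right L2_mult_integrable)

lemma L2_inner_diff_left:
  "\<lbrakk>f \<in> L2; g \<in> L2; h \<in> L2\<rbrakk> \<Longrightarrow> L2_inner (\<lambda>x. f x - g x) h = L2_inner f h - L2_inner g h"
  by (simp add: L2_inner_def left_diff_distrib L2_mult_integrable)

lemma L2_inner_cmult_left: "L2_inner (\<lambda>x. r * f x) h = r * L2_inner f h"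
  by (simp add: L2_inner_def mult.assoc)

lemma L2_inner_add_right:
  "\<lbrakk>f \<in> L2; g \<in> L2; h \<in> L2\<rbrakk> \<Longrightarrow> L2_inner h (\<lambda>x. f x + g x) = L2_inner h f + L2_inner h g"
  using L2_inner_add_left[of f g h] by (simp add: L2_inner_commute)

lemma L2_inner_diff_right:
  "\<lbrakk>f \<in> L2; g \<in> L2; h \<in> L2\<rbrakk> \<Longrightarrow> L2_inner h (\<lambda>x. f x - g x) = L2_inner h f - L2_inner h g"
  using L2_inner_diff_left[of f g h] by (simp add: L2_inner_commute)

lemma L2_inner_cmult_right: "L2_inner h (\<lambda>x. r * f x) = r * L2_inner h f"
  using L2_inner_cmult_left[of r f h] by (simp add: L2_inner_commute)

lemmas L2_inner_linear = L2_inner_add_left L2_inner_diff_left L2_inner_cmult_left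
  L2_inner_add_right L2_inner_diff_right L2_inner_cmult_right

lemma L2_inner_self_nonneg: "0 \<le> L2_inner f f"
  by (simp add: L2_inner_def)

lemma L2_norm_eq: "L2_norm f = sqrt (L2_inner f f)"
  by (simp add: L2_norm_def L2_inner_def power2_eq_square)

lemma L2_norm_square: "(L2_norm f)\<^sup>2 = L2_inner f f"
  by (simp add: L2_norm_eq L2_inner_self_nonneg)

lemma L2_norm_nonneg: "0 \<le> L2_norm f"
  by (simp add: L2_norm_eq L2_inner_self_nonneg)

lemma L2_inner_cong_AE:
  assumes "AE x in unit_measure. f x = f' x" "f \<in> L2" "f' \<in> L2" "g \<in> L2"
  shows "L2_inner g f = L2_inner g f'"
  unfolding L2_inner_def
proof (rule Bochner_Integration.integral_cong_AE)
  show "AE x in unit_measure. g x * f x = g x * f' x"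
    using assms(1) by eventually_elim simp
qed (use assms in measurable)

lemma L2_Young:
  assumes f: "f \<in> L2" and g: "g \<in> L2" and "0 < \<delta>"
  shows "L2_inner f g \<le> \<delta> * L2_inner f f + L2_inner g g / (4 * \<delta>)"
proof -
  have "0 \<le> L2_inner (\<lambda>x. 2 * \<delta> * f x - g x) (\<lambda>x. 2 * \<delta> * f x - g x)"
    by (rule L2_inner_self_nonneg)
  also have "\<dots> = 4 * \<delta>\<^sup>2 * L2_inner f f - 4 * \<delta> * L2_inner f g + L2_inner g g"
    using f g by (simp add: L2_inner_linear L2_intros L2_inner_commute[of g f]) (simp add: algebra_simps power2_eq_square)
  finally show ?thesis
    using \<open>0 < \<delta>\<close> by (simp add: field_simps power2_eq_square)
qed

text \<open>The quadratic form \<open>r\<^sup>2 A - 2 r s C + s\<^sup>2 B\<close> is a squared norm, hence nonnegative. The degenerate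
  case \<open>B = 0\<close> is separate because the usual choice of \<open>r\<close> and \<open>s\<close> gives nothing there.\<close>

lemma L2_Cauchy_Schwarz:
  assumes f: "f \<in> L2" and g: "g \<in> L2"
  shows "\<bar>L2_inner f g\<bar> \<le> L2_norm f * L2_norm g"
proof -
  define A B C where "A = L2_inner f f" and "B = L2_inner g g" and "C = L2_inner f g"
  have quad: "0 \<le> r\<^sup>2 * A - 2 * r * s * C + s\<^sup>2 * B" for r s
  proof -
    have "0 \<le> L2_inner (\<lambda>x. r * f x - s * g x) (\<lambda>x. r * f x - s * g x)"
      by (rule L2_inner_self_nonneg)
    then show ?thesis
      using f g by (simp add: A_def B_def C_def L2_inner_linear L2_intros L2_inner_commute[of g f] algebra_simps power2_eq_square)
  qed
  have "C\<^sup>2 \<le> A * B"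
  proof (cases "B = 0")
    case True
    have "C = 0"
    proof (rule ccontr)
      assume "C \<noteq> 0"
      then show False
        using quad[of 1 "(A + 1) / (2 * C)"] True A_def L2_inner_self_nonneg[of f] by (simp add: field_simps)
    qed
    then show ?thesis using True by simp
  next
    case False
    then have "0 < B" using L2_inner_self_nonneg[of g] by (simp add: B_def)
    moreover have "0 \<le> B * (A * B - C\<^sup>2)"
      using quad[of B C] by (simp add: algebra_simps power2_eq_square)
    ultimately show ?thesis by (simp add: zero_le_mult_iff)
  qed
  then have "\<bar>C\<bar> \<le> sqrt (A * B)"
    by (simp add: real_le_rsqrt)
  then show ?thesis by (simp add: A_def B_def C_def L2_norm_eq real_sqrt_mult)
qed

lemma L2_norm_triangle:
  assumes f: "f \<in> L2" and g: "g \<in> L2"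
  shows "L2_norm (\<lambda>x. f x + g x) \<le> L2_norm f + L2_norm g"
proof (rule power2_le_imp_le)
  have "(L2_norm (\<lambda>x. f x + g x))\<^sup>2 = (L2_norm f)\<^sup>2 + 2 * L2_inner f g + (L2_norm g)\<^sup>2"
    using f g by (simp add: L2_norm_square L2_inner_linear L2_intros L2_inner_commute[of g f])
  also have "\<dots> \<le> (L2_norm f + L2_norm g)\<^sup>2"
    using L2_Cauchy_Schwarz[OF f g] by (simp add: power2_sum)
  finally show "(L2_norm (\<lambda>x. f x + g x))\<^sup>2 \<le> (L2_norm f + L2_norm g)\<^sup>2" .
qed (simp add: L2_norm_nonneg)

lemma L2_norm_cmult: "L2_norm (\<lambda>x. r * f x) = \<bar>r\<bar> * L2_norm f"
  by (simp add: L2_norm_eq L2_inner_linear real_sqrt_mult flip: mult.assoc)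

lemma L2_norm_bounded:
  assumes "f \<in> L2" "\<And>x. x \<in> {0<..<1} \<Longrightarrow> \<bar>f x\<bar> \<le> M" "0 \<le> M"
  shows "L2_norm f \<le> M"
proof -
  have "(LINT x|unit_measure. (f x)\<^sup>2) \<le> (LINT x|unit_measure. M\<^sup>2)"
  proof (rule integral_mono)
    show "integrable unit_measure (\<lambda>x. M\<^sup>2)"
      by (rule integrable_unit_measure_continuous) simp
    show "\<And>x. x \<in> space unit_measure \<Longrightarrow> (f x)\<^sup>2 \<le> M\<^sup>2"
      using assms(2,3) by (simp add: abs_le_square_iff[symmetric])
  qed (rule L2_square_integrable[OF assms(1)])
  also have "(LINT x|unit_measure. M\<^sup>2) = M\<^sup>2"
    by (subst LINT_unit_measure) (auto intro: integrable_unit_measure_continuous)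
  finally show ?thesis
    unfolding L2_norm_def by (rule real_le_lsqrt[OF assms(3)])
qed

section \<open>Limits and derivatives of curves in $L^2(0,1)$\<close>

lemma tendsto_L2_inner:
  assumes w: "\<forall>\<^sub>F s in F. w s \<in> L2" and "v \<in> L2" "\<phi> \<in> L2"
    and lim: "((\<lambda>s. L2_norm (\<lambda>x. w s x - v x)) \<longlongrightarrow> 0) F"
  shows "((\<lambda>s. L2_inner (w s) \<phi>) \<longlongrightarrow> L2_inner v \<phi>) F"
proof -
  have "((\<lambda>s. L2_inner (w s) \<phi> - L2_inner v \<phi>) \<longlongrightarrow> 0) F"
  proof (rule Lim_null_comparison)
    show "\<forall>\<^sub>F s in F. norm (L2_inner (w s) \<phi> - L2_inner v \<phi>)
            \<le> L2_norm (\<lambda>x. w s x - v x) * L2_norm \<phi>"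
      using w
    proof eventually_elim
      case (elim s)
      then show ?case
        using L2_Cauchy_Schwarz[of "\<lambda>x. w s x - v x" \<phi>] assms(2,3) by (simp add: L2_inner_linear L2_intros)
    qed
    show "((\<lambda>s. L2_norm (\<lambda>x. w s x - v x) * L2_norm \<phi>) \<longlongrightarrow> 0) F"
      using tendsto_mult_left_zero[OF lim] .
  qed
  then show ?thesis by (simp add: LIM_zero_iff)
qed

lemma tendsto_L2_norm:
  assumes w: "\<forall>\<^sub>F s in F. w s \<in> L2" and "v \<in> L2"
    and lim: "((\<lambda>s. L2_norm (\<lambda>x. w s x - v x)) \<longlongrightarrow> 0) F"
  shows "((\<lambda>s. L2_norm (w s)) \<longlongrightarrow> L2_norm v) F"
proof -
  have "((\<lambda>s. L2_norm (w s) - L2_norm v) \<longlongrightarrow> 0) F"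
  proof (rule Lim_null_comparison)
    show "\<forall>\<^sub>F s in F. norm (L2_norm (w s) - L2_norm v) \<le> L2_norm (\<lambda>x. w s x - v x)"
      using w
    proof eventually_elim
      case (elim s)
      have 1: "L2_norm (w s) \<le> L2_norm (\<lambda>x. w s x - v x) + L2_norm v"
        using L2_norm_triangle[of "\<lambda>x. w s x - v x" v] elim assms(2) by (simp add: L2_intros)
      have 2: "L2_norm v \<le> L2_norm (\<lambda>x. (-1) * (w s x - v x)) + L2_norm (w s)"
        using L2_norm_triangle[of "\<lambda>x. (-1) * (w s x - v x)" "w s"] elim assms(2) by (simp add: L2_intros)
      show ?case using 1 2 unfolding L2_norm_cmult by simp
    qed
  qed (rule lim)
  then show ?thesis by (simp add: LIM_zero_iff)
qed

lemma L2_quotient_mem: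
  assumes "open I" "t \<in> I" and w: "\<And>s. s \<in> I \<Longrightarrow> w s \<in> L2"
  shows "\<forall>\<^sub>F s in at t. (\<lambda>x. (w s x - w t x) / (s - t)) \<in> L2"
  using eventually_at_in_open'[OF assms(1,2)]
  by eventually_elim (intro L2_intros w assms(2))

lemma L2_inner_quotient:
  assumes "f \<in> L2" "g \<in> L2" "\<phi> \<in> L2"
  shows "L2_inner (\<lambda>x. (f x - g x) / r) \<phi> = (L2_inner f \<phi> - L2_inner g \<phi>) / r"
  using assms L2_inner_linear(3)[of "1/r" "\<lambda>x. f x - g x" \<phi>] by (simp add: L2_inner_linear)

lemma has_L2_derivative_inner:
  assumes I: "open I" "t \<in> I" and w: "\<And>s. s \<in> I \<Longrightarrow> w s \<in> L2"
    and d: "has_L2_derivative w v t" and "\<phi> \<in> L2"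
  shows "((\<lambda>s. L2_inner (w s) \<phi>) has_real_derivative L2_inner v \<phi>) (at t)"
proof -
  have "((\<lambda>s. L2_inner (\<lambda>x. (w s x - w t x) / (s - t)) \<phi>) \<longlongrightarrow> L2_inner v \<phi>) (at t)"
    by (rule tendsto_L2_inner[OF L2_quotient_mem[OF I w]]) (use d \<open>\<phi> \<in> L2\<close> in \<open>auto simp: has_L2_derivative_def\<close>)
  moreover have "\<forall>\<^sub>F s in at t. L2_inner (\<lambda>x. (w s x - w t x) / (s - t)) \<phi>
      = (L2_inner (w s) \<phi> - L2_inner (w t) \<phi>) / (s - t)"
    using eventually_at_in_open'[OF I]
    by eventually_elim (intro L2_inner_quotient w I \<open>\<phi> \<in> L2\<close>)
  ultimately show ?thesis
    unfolding has_field_derivative_iff by (rule Lim_transform_eventually)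
qed

text \<open>With the difference quotient \<open>q\<close> at \<open>t\<close>, the quotient of the squared norms is
  \<open>2 \<langle>q, w t\<rangle> + (s - t) |q|\<^sup>2\<close>, and \<open>|q|\<close> stays bounded.\<close>

lemma has_L2_derivative_norm_square:
  assumes I: "open I" "t \<in> I" and w: "\<And>s. s \<in> I \<Longrightarrow> w s \<in> L2"
    and d: "has_L2_derivative w v t"
  shows "((\<lambda>s. L2_inner (w s) (w s)) has_real_derivative 2 * L2_inner (w t) v) (at t)"
proof -
  let ?q = "\<lambda>s x. (w s x - w t x) / (s - t)"
  note q = L2_quotient_mem[OF I w]
  have v: "v \<in> L2" and lim: "((\<lambda>s. L2_norm (\<lambda>x. ?q s x - v x)) \<longlongrightarrow> 0) (at t)"
    using d by (auto simp: has_L2_derivative_def)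
  have wt: "w t \<in> L2" using w I by blast
  have "((\<lambda>s. 2 * L2_inner (?q s) (w t) + (s - t) * (L2_norm (?q s))\<^sup>2)
      \<longlongrightarrow> 2 * L2_inner v (w t) + (t - t) * (L2_norm v)\<^sup>2) (at t)"
    by (intro tendsto_intros tendsto_L2_inner[OF q v wt lim] tendsto_L2_norm[OF q v lim])
  then have "((\<lambda>s. 2 * L2_inner (?q s) (w t) + (s - t) * (L2_norm (?q s))\<^sup>2)
      \<longlongrightarrow> 2 * L2_inner (w t) v) (at t)"
    by (simp add: L2_inner_commute)
  moreover have "\<forall>\<^sub>F s in at t. 2 * L2_inner (?q s) (w t) + (s - t) * (L2_norm (?q s))\<^sup>2
      = (L2_inner (w s) (w s) - L2_inner (w t) (w t)) / (s - t)"
    using eventually_at_in_open[OF I]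
  proof eventually_elim
    case (elim s)
    then have ws: "w s \<in> L2" and ne: "s - t \<noteq> 0" using w by auto
    have "(L2_norm (?q s))\<^sup>2 = L2_inner (\<lambda>x. w s x - w t x) (?q s) / (s - t)"
      unfolding L2_norm_square
      using L2_inner_linear(3)[of "1 / (s - t)" "\<lambda>x. w s x - w t x" "?q s"] by simp
    also have "L2_inner (\<lambda>x. w s x - w t x) (?q s) = L2_inner (\<lambda>x. w s x - w t x) (\<lambda>x. w s x - w t x) / (s - t)"
      using L2_inner_linear(6)[of "\<lambda>x. w s x - w t x" "1 / (s - t)" "\<lambda>x. w s x - w t x"] by simp
    finally have 1: "(s - t) * (L2_norm (?q s))\<^sup>2 = L2_inner (\<lambda>x. w s x - w t x) (\<lambda>x. w s x - w t x) / (s - t)"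
      using ne by simp
    show ?case
      unfolding 1 L2_inner_quotient[OF ws wt wt]
      by (simp add: L2_inner_linear ws wt L2_intros L2_inner_commute[of "w t" "w s"] add_divide_distrib[symmetric])
  qed
  ultimately show ?thesis
    unfolding has_field_derivative_iff by (rule Lim_transform_eventually)
qed

lemma has_L2_derivative_diff_cmult:
  assumes I: "open I" "t \<in> I" and w: "\<And>s. s \<in> I \<Longrightarrow> w s \<in> L2" and w': "\<And>s. s \<in> I \<Longrightarrow> w' s \<in> L2"
    and d: "has_L2_derivative w v t" and d': "has_L2_derivative w' v' t"
  shows "has_L2_derivative (\<lambda>s x. w s x - r * w' s x) (\<lambda>x. v x - r * v' x) t"
proof -
  let ?q = "\<lambda>s x. (w s x - w t x) / (s - t)" and ?q' = "\<lambda>s x. (w' s x - w' t x) / (s - t)"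
  have q: "\<forall>\<^sub>F s in at t. ?q s \<in> L2" and q': "\<forall>\<^sub>F s in at t. ?q' s \<in> L2"
    by (rule L2_quotient_mem[OF I w] L2_quotient_mem[OF I w']; assumption)+
  have v: "v \<in> L2" "v' \<in> L2" using d d' by (auto simp: has_L2_derivative_def)
  have "((\<lambda>s. L2_norm (\<lambda>x. (w s x - r * w' s x - (w t x - r * w' t x)) / (s - t) - (v x - r * v' x))) \<longlongrightarrow> 0) (at t)"
  proof (rule Lim_null_comparison)
    show "\<forall>\<^sub>F s in at t. norm (L2_norm (\<lambda>x. (w s x - r * w' s x - (w t x - r * w' t x)) / (s - t) - (v x - r * v' x)))
        \<le> L2_norm (\<lambda>x. ?q s x - v x) + \<bar>r\<bar> * L2_norm (\<lambda>x. ?q' s x - v' x)"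
      using q q'
    proof eventually_elim
      case (elim s)
      have "L2_norm (\<lambda>x. (?q s x - v x) + (-r) * (?q' s x - v' x))
          \<le> L2_norm (\<lambda>x. ?q s x - v x) + L2_norm (\<lambda>x. (-r) * (?q' s x - v' x))"
        by (intro L2_norm_triangle L2_diff L2_cmult elim v)
      moreover have "(?q s x - v x) + (-r) * (?q' s x - v' x)
          = (w s x - r * w' s x - (w t x - r * w' t x)) / (s - t) - (v x - r * v' x)" for x
        by (simp add: diff_divide_distrib add_divide_distrib algebra_simps)
      ultimately show ?case by (simp only: L2_norm_cmult) (simp add: L2_norm_nonneg)
    qed
    have "((\<lambda>s. L2_norm (\<lambda>x. ?q s x - v x) + \<bar>r\<bar> * L2_norm (\<lambda>x. ?q' s x - v' x)) \<longlongrightarrow> 0 + \<bar>r\<bar> * 0) (at t)"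
      using d d' by (intro tendsto_intros) (auto simp: has_L2_derivative_def)
    then show "((\<lambda>s. L2_norm (\<lambda>x. ?q s x - v x) + \<bar>r\<bar> * L2_norm (\<lambda>x. ?q' s x - v' x)) \<longlongrightarrow> 0) (at t)"
      by simp
  qed
  then show ?thesis
    using v by (simp add: has_L2_derivative_def L2_intros)
qed

section \<open>Smooth functions with compact support\<close>

text \<open>Recursion over the order of differentiation makes the closure properties of smooth functions provable
  by induction, which is awkward for iterated derivatives of a fixed function.\<close>

fun smooth_upto :: "nat \<Rightarrow> (real \<Rightarrow> real) \<Rightarrow> bool" where
  "smooth_upto 0 f \<longleftrightarrow> True"
| "smooth_upto (Suc n) f \<longleftrightarrow> (\<forall>x. f differentiable (at x)) \<and> smooth_upto n (deriv f)"

lemma smooth_upto_SucD: "smooth_upto (Suc n) f \<Longrightarrow> smooth_upto n f"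
  by (induction n arbitrary: f) auto

lemma differentiable_deriv_pow_iff_smooth_upto:
  "(\<forall>n x. (deriv ^^ n) f differentiable (at x)) \<longleftrightarrow> (\<forall>n. smooth_upto n f)"
proof -
  have "smooth_upto n f \<longleftrightarrow> (\<forall>m<n. \<forall>x. (deriv ^^ m) f differentiable (at x))" for n
  proof (induction n arbitrary: f)
    case (Suc n)
    have "(\<forall>m<Suc n. \<forall>x. (deriv ^^ m) f differentiable (at x)) \<longleftrightarrow>
      (\<forall>x. f differentiable (at x)) \<and> (\<forall>m<n. \<forall>x. (deriv ^^ m) (deriv f) differentiable (at x))"
      by (simp add: All_less_Suc2 funpow_Suc_right del: funpow.simps(2))
    then show ?case using Suc by simp
  qed simp
  then show ?thesis by (metis lessI)
qed

lemma deriv_eqI: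
  assumes "\<And>x. (f has_real_derivative f' x) (at x)"
  shows "deriv f = f'"
  using assms by (auto intro: DERIV_imp_deriv)

lemma smooth_upto_DERIV:
  assumes "smooth_upto (Suc n) f"
  shows "(f has_real_derivative deriv f x) (at x)"
  using assms by (simp add: DERIV_deriv_iff_real_differentiable)

lemma smooth_upto_SucI:
  assumes "\<And>x. (f has_real_derivative f' x) (at x)" "smooth_upto n f'"
  shows "smooth_upto (Suc n) f"
  using assms deriv_eqI[of f f'] by (auto simp: real_differentiable_def)

lemma smooth_upto_add:
  "smooth_upto n f \<Longrightarrow> smooth_upto n g \<Longrightarrow> smooth_upto n (\<lambda>x. f x + g x)"
proof (induction n arbitrary: f g)
  case (Suc n)
  show ?case
    by (rule smooth_upto_SucI[where f' = "\<lambda>x. deriv f x + deriv g x"])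
      (use Suc in \<open>auto intro!: derivative_eq_intros smooth_upto_DERIV\<close>)
qed simp

lemma smooth_upto_mult:
  "smooth_upto n f \<Longrightarrow> smooth_upto n g \<Longrightarrow> smooth_upto n (\<lambda>x. f x * g x)"
proof (induction n arbitrary: f g)
  case (Suc n)
  show ?case
  proof (rule smooth_upto_SucI[where f' = "\<lambda>x. deriv f x * g x + deriv g x * f x"])
    show "((\<lambda>x. f x * g x) has_real_derivative deriv f x * g x + deriv g x * f x) (at x)" for x
      by (intro DERIV_mult smooth_upto_DERIV[OF Suc.prems(1)] smooth_upto_DERIV[OF Suc.prems(2)])
    show "smooth_upto n (\<lambda>x. deriv f x * g x + deriv g x * f x)"
      using Suc.prems smooth_upto_SucD by (intro smooth_upto_add Suc.IH) auto
  qed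
qed simp

lemma smooth_upto_const: "smooth_upto n (\<lambda>x. r)"
proof (induction n arbitrary: r)
  case (Suc n)
  show ?case by (rule smooth_upto_SucI[where f' = "\<lambda>x. 0"]) (use Suc in auto)
qed simp

lemma smooth_upto_cmult: "smooth_upto n f \<Longrightarrow> smooth_upto n (\<lambda>x. r * f x)"
  by (rule smooth_upto_mult[OF smooth_upto_const])

lemma smooth_upto_affine: "smooth_upto n f \<Longrightarrow> smooth_upto n (\<lambda>x. f (r * x + s))"
proof (induction n arbitrary: f)
  case (Suc n)
  show ?case
  proof (rule smooth_upto_SucI[where f' = "\<lambda>x. r * deriv f (r * x + s)"])
    fix x
    have "((\<lambda>x. r * x + s) has_real_derivative r) (at x)"
      by (auto intro!: derivative_eq_intros)
    from DERIV_chain2[OF smooth_upto_DERIV[OF Suc.prems] this]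
    show "((\<lambda>x. f (r * x + s)) has_real_derivative r * deriv f (r * x + s)) (at x)"
      by (simp add: mult.commute)
    show "smooth_upto n (\<lambda>x. r * deriv f (r * x + s))"
      using Suc by (intro smooth_upto_cmult) auto
  qed
qed simp

text \<open>The functions \<open>P (1 / x) exp (- 1 / x)\<close>, extended by zero to the left of the origin. The polynomial factor
  makes this family closed under differentiation, so that each member is smooth.\<close>

definition flat :: "real poly \<Rightarrow> real \<Rightarrow> real" where
  "flat P x = (if x > 0 then poly P (1 / x) * exp (- (1 / x)) else 0)"

text \<open>The exponential beats every polynomial. With \<open>y = 1 / x\<close> this gives the derivative at the origin.\<close>

lemma poly_div_exp_tendsto_0: "((\<lambda>y. poly P y * exp (- y)) \<longlongrightarrow> 0) (at_top :: real filter)"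
proof -
  have "((\<lambda>y. \<Sum>i\<le>degree P. coeff P i * (y ^ i / exp y)) \<longlongrightarrow> (\<Sum>i\<le>degree P. coeff P i * 0)) at_top"
    by (intro tendsto_intros tendsto_power_div_exp_0)
  moreover have "(\<lambda>y. \<Sum>i\<le>degree P. coeff P i * (y ^ i / exp y)) = (\<lambda>y. poly P y * exp (- y))"
    by (auto simp: poly_altdef exp_minus field_simps sum_divide_distrib)
  ultimately show ?thesis by simp
qed

lemma flat_DERIV:
  "(flat P has_real_derivative flat ([:0, 0, 1:] * (P - pderiv P)) x) (at x)"
proof -
  consider "x < 0" | "x > 0" | "x = 0" by linarith
  then show ?thesis
  proof cases
    case 1
    have "((\<lambda>x. 0) has_real_derivative 0) (at x)" by simp
    then have "(flat P has_real_derivative 0) (at x)"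
      by (rule has_field_derivative_transform_within_open[where S = "{..<0}"])
        (use 1 in \<open>auto simp: flat_def\<close>)
    then show ?thesis using 1 by (simp add: flat_def)
  next
    case 2
    have "((\<lambda>x. poly P (1 / x) * exp (- (1 / x))) has_real_derivative
        flat ([:0, 0, 1:] * (P - pderiv P)) x) (at x)"
      using 2 by (auto intro!: derivative_eq_intros DERIV_chain2[OF poly_DERIV] simp: flat_def field_simps power2_eq_square)
    then show ?thesis
      by (rule has_field_derivative_transform_within_open[where S = "{0<..}"])
        (use 2 in \<open>auto simp: flat_def\<close>)
  next
    case 3
    have "((\<lambda>h. flat P h / h) \<longlongrightarrow> 0) (at 0)"
      unfolding filterlim_at_split
    proof
      have "\<forall>\<^sub>F h in at_left (0::real). 0 = flat P h / h"
        by (auto simp: eventually_at_filter flat_def)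
      then show "((\<lambda>h. flat P h / h) \<longlongrightarrow> 0) (at_left 0)"
        by (rule Lim_transform_eventually[OF tendsto_const])
      have "((\<lambda>h. poly (pCons 0 P) (inverse h) * exp (- (inverse h))) \<longlongrightarrow> 0) (at_right (0::real))"
        using filterlim_compose[OF poly_div_exp_tendsto_0 filterlim_inverse_at_top_right] .
      moreover have "\<forall>\<^sub>F h in at_right (0::real). poly (pCons 0 P) (inverse h) * exp (- (inverse h)) = flat P h / h"
        by (auto simp: eventually_at_filter flat_def field_simps)
      ultimately show "((\<lambda>h. flat P h / h) \<longlongrightarrow> 0) (at_right 0)"
        by (rule Lim_transform_eventually)
    qed
    then show ?thesis using 3 by (simp add: has_field_derivative_iff flat_def)
  qed
qed

lemma smooth_upto_flat: "smooth_upto n (flat P)"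
proof (induction n arbitrary: P)
  case (Suc n)
  show ?case by (rule smooth_upto_SucI[OF flat_DERIV Suc])
qed simp

text \<open>For \<open>r > 0\<close>, a smooth function that is positive exactly on \<open>{p<..<q}\<close>. Since only \<open>r (x - p)\<close> and \<open>r (q - x)\<close> enter,
  a large \<open>r\<close> pushes it towards \<open>1\<close> inside the interval.\<close>

definition bump :: "real \<Rightarrow> real \<Rightarrow> real \<Rightarrow> real \<Rightarrow> real" where
  "bump p q r x = flat 1 (r * x + (- r * p)) * flat 1 ((- r) * x + r * q)"

lemma bump_outside: "0 < r \<Longrightarrow> x \<notin> {p<..<q} \<Longrightarrow> bump p q r x = 0"
  by (auto simp: bump_def flat_def not_less mult_le_cancel_left)

lemma bump_inside:
  assumes "0 < r" "x \<in> {p<..<q}"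
  shows "bump p q r x = exp (- (1 / (r * (x - p)))) * exp (- (1 / (r * (q - x))))"
proof -
  have "r * x + (- r * p) = r * (x - p)" "(- r) * x + r * q = r * (q - x)"
    by (simp_all add: algebra_simps)
  moreover have "0 < r * (x - p)" "0 < r * (q - x)"
    using assms by auto
  ultimately show ?thesis
    by (simp only: bump_def flat_def if_True poly_1 mult_1)
qed

lemma test_function_bump:
  assumes "0 < p" "q < 1" "0 < r"
  shows "test_function (bump p q r)"
proof -
  have "smooth_upto n (bump p q r)" for n
    unfolding bump_def by (intro smooth_upto_mult smooth_upto_affine smooth_upto_flat)
  moreover have "\<forall>x. x \<notin> {p..q} \<longrightarrow> bump p q r x = 0"
    using bump_outside[OF assms(3)] by (auto simp: not_le)
  ultimately show ?thesis
    unfolding test_function_def differentiable_deriv_pow_iff_smooth_upto using assms by blast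
qed

lemma test_function_lincomb:
  assumes \<phi>: "test_function \<phi>" and \<psi>: "test_function \<psi>"
  shows "test_function (\<lambda>x. r * \<phi> x + s * \<psi> x)"
proof -
  obtain p q p' q' where "0 < p" "q < 1" "\<forall>x. x \<notin> {p..q} \<longrightarrow> \<phi> x = 0"
    and "0 < p'" "q' < 1" "\<forall>x. x \<notin> {p'..q'} \<longrightarrow> \<psi> x = 0"
    using \<phi> \<psi> unfolding test_function_def by metis
  then have "0 < min p p'" "max q q' < 1" "\<forall>x. x \<notin> {min p p'..max q q'} \<longrightarrow> r * \<phi> x + s * \<psi> x = 0"
    by (auto simp: not_le)
  moreover have "\<forall>n. smooth_upto n (\<lambda>x. r * \<phi> x + s * \<psi> x)"
    using \<phi> \<psi> unfolding test_function_def differentiable_deriv_pow_iff_smooth_upto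
    by (auto intro!: smooth_upto_add smooth_upto_cmult)
  ultimately show ?thesis
    unfolding test_function_def differentiable_deriv_pow_iff_smooth_upto by blast
qed

lemma test_function_DERIV:
  assumes "test_function \<phi>"
  shows "(\<phi> has_real_derivative deriv \<phi> x) (at x)"
  using assms unfolding test_function_def differentiable_deriv_pow_iff_smooth_upto
  by (blast intro: smooth_upto_DERIV)

lemma test_function_deriv:
  assumes "test_function \<phi>"
  shows "test_function (deriv \<phi>)"
proof -
  obtain p q where pq: "0 < p" "q < 1" "\<forall>x. x \<notin> {p..q} \<longrightarrow> \<phi> x = 0"
    using assms unfolding test_function_def by blast
  have "deriv \<phi> x = 0" if "x \<notin> {p..q}" for x
  proof -
    have "((\<lambda>x. 0) has_real_derivative 0) (at x)" by simp
    then have "(\<phi> has_real_derivative 0) (at x)"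
      by (rule has_field_derivative_transform_within_open[where S = "- {p..q}"]) (use that pq in auto)
    then show ?thesis by (rule DERIV_imp_deriv)
  qed
  moreover have "\<forall>n. smooth_upto n (deriv \<phi>)"
    using assms unfolding test_function_def differentiable_deriv_pow_iff_smooth_upto
    by (metis smooth_upto.simps(2))
  ultimately show ?thesis
    unfolding test_function_def differentiable_deriv_pow_iff_smooth_upto using pq by blast
qed

lemma test_function_continuous: "test_function \<phi> \<Longrightarrow> continuous_on A \<phi>"
  by (meson test_function_DERIV DERIV_isCont continuous_at_imp_continuous_on)

text \<open>The vanishing mean makes the antiderivative zero on both sides of the support of \<open>\<psi>\<close>, so it has
  compact support again.\<close>

lemma test_function_antiderivative:
  assumes \<psi>: "test_function \<psi>" and mean: "integral {0..1} \<psi> = 0"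
  obtains \<phi> where "test_function \<phi>" "deriv \<phi> = \<psi>"
proof -
  have "\<And>x. isCont \<psi> x"
    using test_function_DERIV[OF \<psi>] DERIV_isCont by blast
  then obtain F where F: "\<And>x. (F has_real_derivative \<psi> x) (at x)"
    using einterval_antiderivative[of "-\<infinity>" "\<infinity>" \<psi>]
    by (auto simp: has_real_derivative_iff_has_vector_derivative)
  define \<phi> where "\<phi> x = F x - F 0" for x
  have \<phi>: "(\<phi> has_real_derivative \<psi> x) (at x)" for x
    unfolding \<phi>_def by (auto intro!: derivative_eq_intros F)
  obtain p q where pq: "0 < p" "q < 1" "\<forall>x. x \<notin> {p..q} \<longrightarrow> \<psi> x = 0"
    using \<psi> unfolding test_function_def by blast
  have "(\<psi> has_integral (\<phi> 1 - \<phi> 0)) {0..1}"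
    by (rule fundamental_theorem_of_calculus)
      (use \<phi> in \<open>auto intro: has_field_derivative_at_within simp flip: has_real_derivative_iff_has_vector_derivative\<close>)
  then have "\<phi> 1 = 0" "\<phi> 0 = 0" using mean by (auto simp: \<phi>_def integral_unique)
  have const: "\<phi> x = \<phi> y" if "x \<in> S" "y \<in> S" "convex S" "S \<inter> {p..q} = {}" for x y S
  proof -
    have "(\<phi> has_real_derivative 0) (at x within S)" if "x \<in> S" for x
      using \<phi>[of x] pq that \<open>S \<inter> {p..q} = {}\<close> by (metis disjoint_iff has_field_derivative_at_within)
    then obtain k where "\<And>x. x \<in> S \<Longrightarrow> \<phi> x = k"
      using has_field_derivative_zero_constant[OF \<open>convex S\<close>] by metis
    then show ?thesis using that by metis
  qed
  have "\<phi> x = 0" if "x \<notin> {p..q}" for x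
  proof (cases "x < p")
    case True
    moreover have "{..<p} \<inter> {p..q} = {}" by auto
    ultimately show ?thesis using const[of x "{..<p}" 0] pq \<open>\<phi> 0 = 0\<close> by simp
  next
    case False
    then have "q < x" using that by auto
    moreover have "{q<..} \<inter> {p..q} = {}" by auto
    ultimately show ?thesis using const[of x "{q<..}" 1] pq \<open>\<phi> 1 = 0\<close> by simp
  qed
  moreover have deriv: "deriv \<phi> = \<psi>" using \<phi> by (rule deriv_eqI)
  moreover have "smooth_upto n \<phi>" for n
  proof (cases n)
    case (Suc m)
    then show ?thesis
      using smooth_upto_SucI[OF \<phi>, of m] \<psi>
      unfolding test_function_def differentiable_deriv_pow_iff_smooth_upto by blast
  qed simp
  ultimately have "test_function \<phi>"
    unfolding test_function_def differentiable_deriv_pow_iff_smooth_upto using pq by blast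
  then show ?thesis using deriv that by blast
qed

section \<open>Integration by parts for indefinite integrals\<close>

lemma L2_absolutely_integrable:
  assumes "f \<in> L2"
  shows "f absolutely_integrable_on {0..1}"
proof -
  have "f absolutely_integrable_on {0<..<1}"
    using L2_integrable[OF assms] by (simp add: integrable_restrict_space set_integrable_def)
  then show ?thesis
    using absolutely_integrable_on_open_interval[where f = f and a = 0 and b = 1] by simp
qed

lemma L2_integrable_on:
  assumes "f \<in> L2" "0 \<le> x" "y \<le> 1"
  shows "f integrable_on {x..y}"
  using set_lebesgue_integral_eq_integral(1)[OF absolutely_integrable_on_subinterval[OF L2_absolutely_integrable[OF assms(1)]], of x y] assms
  by auto

lemma L2_inner_integral:
  "f \<in> L2 \<Longrightarrow> g \<in> L2 \<Longrightarrow> L2_inner f g = integral {0..1} (\<lambda>x. f x * g x)"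
  unfolding L2_inner_def by (intro LINT_unit_measure L2_mult_integrable)

lemma continuous_on_unit_bound:
  assumes "continuous_on {0..1::real} (\<phi> :: real \<Rightarrow> real)"
  obtains B where "\<And>x. x \<in> {0..1} \<Longrightarrow> \<bar>\<phi> x\<bar> \<le> B"
proof -
  have "bounded (\<phi> ` {0..1})"
    by (intro compact_imp_bounded compact_continuous_image assms compact_Icc)
  then show ?thesis
    using that unfolding bounded_iff by (metis imageI real_norm_def)
qed

lemma L2_mult_continuous:
  assumes "f \<in> L2" "continuous_on {0..1} \<phi>"
  shows "(\<lambda>x. f x * \<phi> x) \<in> L2"
proof -
  obtain B where B: "\<And>x. x \<in> {0..1} \<Longrightarrow> \<bar>\<phi> x\<bar> \<le> B"
    using continuous_on_unit_bound[OF assms(2)] by blast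
  have "integrable unit_measure (\<lambda>x. (f x * \<phi> x)\<^sup>2)"
  proof (rule Bochner_Integration.integrable_bound)
    show "integrable unit_measure (\<lambda>x. B\<^sup>2 * (f x)\<^sup>2)"
      using L2_square_integrable[OF assms(1)] by simp
    show "(\<lambda>x. (f x * \<phi> x)\<^sup>2) \<in> borel_measurable unit_measure"
      using assms(1) L2_continuous[OF assms(2)] by measurable
    have "(f x * \<phi> x)\<^sup>2 \<le> B\<^sup>2 * (f x)\<^sup>2" if "x \<in> {0<..<1}" for x
    proof -
      have "(\<phi> x)\<^sup>2 \<le> B\<^sup>2"
        using B[of x] that by (simp add: abs_le_square_iff[symmetric])
      then show ?thesis using mult_right_mono[of "(\<phi> x)\<^sup>2" "B\<^sup>2" "(f x)\<^sup>2"] by (simp add: power_mult_distrib mult.commute)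
    qed
    then show "AE x in unit_measure. norm ((f x * \<phi> x)\<^sup>2) \<le> norm (B\<^sup>2 * (f x)\<^sup>2)"
      by (intro AE_I2) simp
  qed
  moreover have "(\<lambda>x. f x * \<phi> x) \<in> borel_measurable unit_measure"
    using assms(1) L2_continuous[OF assms(2)] by measurable
  ultimately show ?thesis by (simp add: L2_def)
qed

text \<open>The Cauchy-Schwarz inequality with an indicator function, whose norm is at most one. All Poincare-type
  estimates below are instances.\<close>

lemma abs_integral_le_L2_norm:
  assumes "f \<in> L2" "0 \<le> x" "y \<le> 1"
  shows "\<bar>integral {x..y} f\<bar> \<le> L2_norm f"
proof -
  let ?i = "indicat_real {x..y}"
  have m: "?i \<in> borel_measurable unit_measure"
    by (rule measurable_restrict_space1, rule borel_measurable_indicator) simp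
  have i: "?i \<in> L2"
  proof -
    have [simp]: "(?i z)\<^sup>2 = ?i z" for z
      by (simp add: indicator_def)
    have "integrable unit_measure (\<lambda>x. (?i x)\<^sup>2)"
      by (rule Bochner_Integration.integrable_bound[OF integrable_unit_measure_continuous[of "\<lambda>_. 1"]])
        (use m in simp_all)
    then show ?thesis using m by (simp add: L2_def)
  qed
  have "integral {x..y} f = integral {0..1} (\<lambda>z. f z * ?i z)"
  proof -
    have "integral {0..1} (\<lambda>z. f z * ?i z) = integral {0..1} (\<lambda>z. if z \<in> {x..y} then f z else 0)"
      by (intro arg_cong[of _ _ "integral {0..1}"]) (auto simp: indicator_def)
    then show ?thesis
      using Henstock_Kurzweil_Integration.integral_restrict_Int[of "{0..1}" "{x..y}" f] assms(2,3)
      by (simp add: Int_absorb2)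
  qed
  also have "\<dots> = L2_inner f ?i"
    using L2_inner_integral[OF assms(1) i] by simp
  finally have "\<bar>integral {x..y} f\<bar> \<le> L2_norm f * L2_norm ?i"
    using L2_Cauchy_Schwarz[OF assms(1) i] by simp
  moreover have "L2_norm ?i \<le> 1"
    by (rule L2_norm_bounded[OF i]) (auto simp: indicator_def)
  ultimately show ?thesis
    using mult_left_mono[of "L2_norm ?i" 1 "L2_norm f"] L2_norm_nonneg[of f] by simp
qed

text \<open>The indefinite integral \<open>H\<close> of \<open>h\<close> need not be differentiable at any given point, so the fundamental theorem
  of calculus cannot be applied to \<open>H \<phi>\<close>. Instead, let \<open>D x\<close> be the difference of the two sides on
  \<open>{0..x}\<close>. Over \<open>{x..y}\<close> it changes by \<open>\<integral> h (\<phi> - \<phi> y) + \<integral> (H - H x) \<phi>'\<close>, which is at most a constant times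
  \<open>(y - x) \<integral> |h|\<close>. The last integral tends to zero as \<open>y\<close> tends to \<open>x\<close>, so \<open>D\<close> has derivative zero everywhere
  and is constant.\<close>

lemma integration_by_parts_L2:
  assumes h: "h \<in> L2" and \<phi>': "continuous_on {0..1} \<phi>'"
    and d: "\<And>x. x \<in> {0..1} \<Longrightarrow> (\<phi> has_real_derivative \<phi>' x) (at x within {0..1})"
  shows "L2_inner h \<phi> + L2_inner (\<lambda>x. integral {0..x} h) \<phi>' = integral {0..1} h * \<phi> 1"
proof -
  have \<phi>: "continuous_on {0..1} \<phi>"
    by (rule DERIV_continuous_on[OF d])
  define H where "H x = integral {0..x} h" for x
  define A where "A x = integral {0..x} (\<lambda>z. \<bar>h z\<bar>)" for x
  define D where "D x = integral {0..x} (\<lambda>z. h z * \<phi> z) + integral {0..x} (\<lambda>z. H z * \<phi>' z) - H x * \<phi> x" for x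
  have ah: "(\<lambda>z. \<bar>h z\<bar>) integrable_on {0..1}"
    using L2_absolutely_integrable[OF h] by (simp add: absolutely_integrable_on_def)
  have H_cont: "continuous_on {0..1} H"
    unfolding H_def by (intro indefinite_integral_continuous_1 L2_integrable_on h) auto
  have A_cont: "continuous_on {0..1} A"
    unfolding A_def by (rule indefinite_integral_continuous_1[OF ah])
  have hphi: "(\<lambda>z. h z * \<phi> z) \<in> L2"
    by (rule L2_mult_continuous[OF h \<phi>])
  have Hphi: "continuous_on {0..1} (\<lambda>z. H z * \<phi>' z)"
    by (intro continuous_intros H_cont \<phi>')
  obtain M where M: "\<And>x. x \<in> {0..1} \<Longrightarrow> \<bar>\<phi>' x\<bar> \<le> M"
    using continuous_on_unit_bound[OF \<phi>'] by blast
  have M0: "0 \<le> M" using M[of 0] by auto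
  have key: "\<bar>D y - D x\<bar> \<le> 2 * M * \<bar>y - x\<bar> * \<bar>A y - A x\<bar>" if "x \<in> {0..1}" "y \<in> {0..1}" "x \<le> y" for x y
  proof -
    have sub: "{x..y} \<subseteq> {0..1}" using that by auto
    have comb: "integral {0..y} k - integral {0..x} k = integral {x..y} k"
      if "k integrable_on {0..1}" for k :: "real \<Rightarrow> real"
    proof -
      have "k integrable_on {0..y}" by (rule integrable_on_subinterval[OF that]) (use \<open>y \<in> _\<close> in auto)
      from Henstock_Kurzweil_Integration.integral_combine[OF _ \<open>x \<le> y\<close> this] \<open>x \<in> _\<close>
      show ?thesis by simp
    qed
    have hi: "h integrable_on {x..y}" using that by (intro L2_integrable_on h) auto
    have hphii: "(\<lambda>z. h z * \<phi> z) integrable_on {x..y}" using that by (intro L2_integrable_on hphi) auto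
    have Ai: "(\<lambda>z. \<bar>h z\<bar>) integrable_on {x..y}" by (rule integrable_on_subinterval[OF ah sub])
    have Hi: "(\<lambda>z. H z * \<phi>' z) integrable_on {x..y}" "\<phi>' integrable_on {x..y}"
      by (intro integrable_continuous_real continuous_on_subset[OF Hphi sub] continuous_on_subset[OF \<phi>' sub])+
    have H_diff: "H z - H x = integral {x..z} h" if "z \<in> {x..y}" for z
    proof -
      have "h integrable_on {0..z}" using that \<open>x \<in> _\<close> \<open>y \<in> _\<close> by (intro L2_integrable_on h) auto
      from Henstock_Kurzweil_Integration.integral_combine[OF _ _ this, of x] that \<open>x \<in> _\<close>
      show ?thesis by (simp add: H_def)
    qed
    have A_diff: "A y - A x = integral {x..y} (\<lambda>z. \<bar>h z\<bar>)"
      unfolding A_def by (rule comb[OF ah])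
    have A_nn: "0 \<le> A y - A x"
      unfolding A_diff by (rule Henstock_Kurzweil_Integration.integral_nonneg[OF Ai]) simp
    have phi_diff: "integral {z..y} \<phi>' = \<phi> y - \<phi> z" if "z \<in> {x..y}" for z
    proof (rule integral_unique[OF fundamental_theorem_of_calculus])
      fix s assume "s \<in> {z..y}"
      then show "(\<phi> has_vector_derivative \<phi>' s) (at s within {z..y})"
        using d[of s] that sub
        by (auto simp: has_real_derivative_iff_has_vector_derivative[symmetric] intro: DERIV_subset)
    qed (use that in auto)
    have phi_lip: "\<bar>\<phi> z - \<phi> y\<bar> \<le> M * (y - x)" if "z \<in> {x..y}" for z
    proof -
      have "norm (integral {z..y} \<phi>') \<le> M * (y - z)"
        by (rule integral_bound)
          (use that sub M in \<open>auto intro!: continuous_on_subset[OF \<phi>']\<close>)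
      also have "\<dots> \<le> M * (y - x)" using M0 that by (intro mult_left_mono) auto
      finally show ?thesis using phi_diff[OF that] by simp
    qed
    have i1: "(\<lambda>z. h z * (\<phi> z - \<phi> y)) integrable_on {x..y}"
      using integrable_diff[OF hphii integrable_on_mult_left[OF hi, of "\<phi> y"]]
      by (simp add: algebra_simps)
    have i2: "(\<lambda>z. (H z - H x) * \<phi>' z) integrable_on {x..y}"
      using integrable_diff[OF Hi(1) integrable_on_mult_right[OF Hi(2), of "H x"]]
      by (simp add: algebra_simps)
    have "integral {x..y} (\<lambda>z. h z * (\<phi> z - \<phi> y)) = integral {x..y} (\<lambda>z. h z * \<phi> z) - (H y - H x) * \<phi> y"
      using Henstock_Kurzweil_Integration.integral_diff[OF hphii integrable_on_mult_left[OF hi, of "\<phi> y"]] H_diff[of y] that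
      by (simp add: algebra_simps)
    moreover have "integral {x..y} (\<lambda>z. (H z - H x) * \<phi>' z) = integral {x..y} (\<lambda>z. H z * \<phi>' z) - H x * (\<phi> y - \<phi> x)"
      using Henstock_Kurzweil_Integration.integral_diff[OF Hi(1) integrable_on_mult_right[OF Hi(2), of "H x"]] phi_diff[of x] that
      by (simp add: algebra_simps)
    ultimately have D_eq: "D y - D x = integral {x..y} (\<lambda>z. h z * (\<phi> z - \<phi> y)) + integral {x..y} (\<lambda>z. (H z - H x) * \<phi>' z)"
      using comb[OF L2_integrable_on[OF hphi, of 0 1]] comb[OF integrable_continuous_real[OF Hphi]]
      by (simp add: D_def algebra_simps)
    have b1: "norm (integral {x..y} (\<lambda>z. h z * (\<phi> z - \<phi> y))) \<le> integral {x..y} (\<lambda>z. M * (y - x) * \<bar>h z\<bar>)"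
    proof (rule integral_norm_bound_integral[OF i1])
      show "norm (h z * (\<phi> z - \<phi> y)) \<le> M * (y - x) * \<bar>h z\<bar>" if "z \<in> {x..y}" for z
        using mult_right_mono[OF phi_lip[OF that], of "\<bar>h z\<bar>"] by (simp add: abs_mult mult.commute)
    qed (use integrable_on_mult_right[OF Ai] in simp)
    have H_bd: "\<bar>H z - H x\<bar> \<le> A y - A x" if z: "z \<in> {x..y}" for z
    proof -
      have s: "h integrable_on {x..z}" "(\<lambda>s. \<bar>h s\<bar>) integrable_on {x..z}"
        using integrable_on_subinterval[OF hi, of x z] integrable_on_subinterval[OF Ai, of x z] z by auto
      have "norm (integral {x..z} h) \<le> integral {x..z} (\<lambda>s. \<bar>h s\<bar>)"
        by (rule integral_norm_bound_integral[OF s]) simp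
      also have "\<dots> \<le> integral {x..y} (\<lambda>s. \<bar>h s\<bar>)"
        by (rule integral_subset_le[OF _ s(2) Ai]) (use z in auto)
      finally show ?thesis using H_diff[OF z] A_diff by simp
    qed
    have b2: "norm (integral {x..y} (\<lambda>z. (H z - H x) * \<phi>' z)) \<le> integral {x..y} (\<lambda>z. (A y - A x) * M)"
    proof (rule integral_norm_bound_integral[OF i2])
      show "norm ((H z - H x) * \<phi>' z) \<le> (A y - A x) * M" if "z \<in> {x..y}" for z
        using H_bd[OF that] M[of z] that sub A_nn by (auto simp: abs_mult intro!: mult_mono)
    qed (rule integrable_const_ivl)
    have "\<bar>D y - D x\<bar> \<le> M * (y - x) * (A y - A x) + (A y - A x) * M * (y - x)"
    proof -
      have "\<bar>integral {x..y} (\<lambda>z. h z * (\<phi> z - \<phi> y))\<bar> \<le> M * (y - x) * (A y - A x)"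
        using b1 A_diff by simp
      moreover have "\<bar>integral {x..y} (\<lambda>z. (H z - H x) * \<phi>' z)\<bar> \<le> (A y - A x) * M * (y - x)"
        using b2 \<open>x \<le> y\<close> by (simp add: ac_simps)
      ultimately show ?thesis unfolding D_eq by linarith
    qed
    then show ?thesis using A_nn \<open>x \<le> y\<close> by (simp add: algebra_simps)
  qed
  have "(D has_real_derivative 0) (at x within {0..1})" if x: "x \<in> {0..1}" for x
  proof -
    have "((\<lambda>y. (D y - D x) / (y - x)) \<longlongrightarrow> 0) (at x within {0..1})"
    proof (rule Lim_null_comparison)
      show "\<forall>\<^sub>F y in at x within {0..1}. norm ((D y - D x) / (y - x)) \<le> 2 * M * \<bar>A y - A x\<bar>"
        unfolding eventually_at_filter
      proof (rule always_eventually, intro allI impI)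
        fix y assume y: "y \<noteq> x" "y \<in> {0..1}"
        have "\<bar>D y - D x\<bar> \<le> 2 * M * \<bar>y - x\<bar> * \<bar>A y - A x\<bar>"
          using key[of x y] key[of y x] x y by (cases "x \<le> y") (auto simp: abs_minus_commute)
        then show "norm ((D y - D x) / (y - x)) \<le> 2 * M * \<bar>A y - A x\<bar>"
          using y(1) by (simp add: abs_divide field_simps)
      qed
      have "((\<lambda>y. 2 * M * \<bar>A y - A x\<bar>) \<longlongrightarrow> 2 * M * \<bar>A x - A x\<bar>) (at x within {0..1})"
        using A_cont x by (intro tendsto_intros) (auto simp: continuous_on_def)
      then show "((\<lambda>y. 2 * M * \<bar>A y - A x\<bar>) \<longlongrightarrow> 0) (at x within {0..1})" by simp
    qed
    then show ?thesis by (simp add: has_field_derivative_iff)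
  qed
  then obtain k where "\<And>x. x \<in> {0..1} \<Longrightarrow> D x = k"
    using has_field_derivative_zero_constant[of "{0..1}" D] by auto
  then have "D 1 = D 0" by simp
  then have "integral {0..1} (\<lambda>z. h z * \<phi> z) + integral {0..1} (\<lambda>z. H z * \<phi>' z) = H 1 * \<phi> 1"
    by (simp add: D_def H_def)
  then show ?thesis
    using L2_inner_integral[OF h L2_continuous[OF \<phi>]] L2_inner_continuous[OF H_cont \<phi>']
    unfolding H_def by simp
qed

section \<open>The fundamental lemma of the calculus of variations\<close>

lemma bump_le_1: "0 < r \<Longrightarrow> \<bar>bump p q r x\<bar> \<le> 1"
proof (cases "x \<in> {p<..<q}")
  case True
  assume "0 < r"
  with True show ?thesis
    unfolding bump_inside[OF \<open>0 < r\<close> True] abs_mult by (intro mult_le_one) auto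
qed (simp add: bump_outside)

lemma bump_tendsto_indicator:
  assumes p: "p \<longlonglongrightarrow> p'" and q: "q \<longlonglongrightarrow> q'" and x: "x \<noteq> p'" "x \<noteq> q'"
  shows "(\<lambda>n. bump (p n) (q n) (real (Suc n)) x) \<longlonglongrightarrow> indicator {p'<..<q'} x"
proof (cases "x \<in> {p'<..<q'}")
  case True
  have top: "filterlim (\<lambda>n. real (Suc n)) at_top sequentially"
    by (rule filterlim_compose[OF filterlim_real_sequentially filterlim_Suc])
  have inv: "(\<lambda>n. inverse (real (Suc n) * y n)) \<longlonglongrightarrow> 0" if "y \<longlonglongrightarrow> y'" "0 < y'" for y y'
    by (rule tendsto_inverse_0_at_top, rule filterlim_at_top_mult_tendsto_pos[OF that top])
  have "(\<lambda>n. inverse (real (Suc n) * (x - p n))) \<longlonglongrightarrow> 0" "(\<lambda>n. inverse (real (Suc n) * (q n - x))) \<longlonglongrightarrow> 0"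
    by (rule inv[OF tendsto_diff[OF tendsto_const p]] inv[OF tendsto_diff[OF q tendsto_const]]; use True in simp)+
  then have "(\<lambda>n. exp (- inverse (real (Suc n) * (x - p n))) * exp (- inverse (real (Suc n) * (q n - x)))) \<longlonglongrightarrow> exp (-0) * exp (-0)"
    by (intro tendsto_intros)
  moreover have "\<forall>\<^sub>F n in sequentially. exp (- inverse (real (Suc n) * (x - p n))) * exp (- inverse (real (Suc n) * (q n - x)))
      = bump (p n) (q n) (real (Suc n)) x"
  proof -
    have "\<forall>\<^sub>F n in sequentially. p n < x" "\<forall>\<^sub>F n in sequentially. x < q n"
      using True order_tendstoD(2)[OF p, of x] order_tendstoD(1)[OF q, of x] by auto
    then show ?thesis
      by eventually_elim (simp add: bump_inside divide_inverse)
  qed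
  ultimately have "(\<lambda>n. bump (p n) (q n) (real (Suc n)) x) \<longlonglongrightarrow> exp (-0) * exp (-0)"
    by (rule Lim_transform_eventually)
  then show ?thesis using True by simp
next
  case False
  then have "x < p' \<or> q' < x" using x by auto
  then have "\<forall>\<^sub>F n in sequentially. x < p n \<or> q n < x"
    using order_tendstoD(1)[OF p, of x] order_tendstoD(2)[OF q, of x]
    by (auto elim: eventually_mono)
  then have "\<forall>\<^sub>F n in sequentially. 0 = bump (p n) (q n) (real (Suc n)) x"
    by eventually_elim (subst bump_outside, auto)
  then have "(\<lambda>n. bump (p n) (q n) (real (Suc n)) x) \<longlonglongrightarrow> 0"
    by (rule Lim_transform_eventually[OF tendsto_const])
  then show ?thesis using False by simp
qed

text \<open>Intervals generate the Borel sets and are stable under intersection, so the integral of \<open>k\<close> vanishes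
  over every Borel set, and over every Lebesgue set because that differs from a Borel set by a null set.\<close>

lemma AE_zero_if_integral_intervals_zero:
  fixes k :: "real \<Rightarrow> real"
  assumes k: "integrable lebesgue k" and total: "(LINT x|lebesgue. k x) = 0"
    and int: "\<And>p q. p \<le> q \<Longrightarrow> (LINT x:{p..q}|lebesgue. k x) = 0"
  shows "AE x in lebesgue. k x = 0"
proof (rule sigma_finite_measure.density_zero[OF _ k])
  show "sigma_finite_measure (lebesgue :: real measure)"
  proof
    obtain A :: "real set set" where A: "countable A" "A \<subseteq> sets lborel" "\<Union>A = space lborel" "\<forall>a\<in>A. emeasure lborel a \<noteq> \<infinity>"
      using lborel.sigma_finite_countable by blast
    then show "\<exists>A::real set set. countable A \<and> A \<subseteq> sets lebesgue \<and> \<Union>A = space lebesgue \<and> (\<forall>a\<in>A. emeasure lebesgue a \<noteq> \<infinity>)"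
      by (intro exI[of _ A]) (auto simp: emeasure_completion subset_iff)
  qed
  have set_int: "set_integrable lebesgue B k" if "B \<in> sets lebesgue" for B
    using integrable_mult_indicator[OF that k] by (simp add: set_integrable_def)
  have borel: "(LINT x:B|lebesgue. k x) = 0" if "B \<in> sets borel" for B
    using that
  proof (induction rule: borel_set_induct)
    case (compl A)
    have A: "A \<in> sets lebesgue" "- A \<in> sets lebesgue" using compl(1) by (auto intro: sets_completionI_sets)
    have "(LINT x:A \<union> - A|lebesgue. k x) = (LINT x:A|lebesgue. k x) + (LINT x:- A|lebesgue. k x)"
      by (rule set_integral_Un) (use A set_int in auto)
    then show ?case using compl(2) total by (simp add: set_lebesgue_integral_def)
  next
    case (union A)
    have A: "A i \<in> sets lebesgue" for i using union(2) by (auto intro: sets_completionI_sets)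
    have "(LINT x:(\<Union>i. A i)|lebesgue. k x) = (\<Sum>i. (LINT x:A i|lebesgue. k x))"
      by (rule lebesgue_integral_countable_add)
        (use A set_int union(1) in \<open>auto simp: disjoint_family_on_def\<close>)
    then show ?case using union(3) by simp
  qed (use int in \<open>auto simp: set_lebesgue_integral_def\<close>)
  fix A :: "real set" assume A: "A \<in> sets lebesgue"
  obtain S N N' where S: "A = S \<union> N" "S \<in> sets lborel" "N' \<in> null_sets lborel" "N \<subseteq> N'"
    using A by (rule sets_completionE)
  have "AE x in lebesgue. x \<notin> N"
    using S(3,4) by (intro AE_completion) (auto intro: AE_I')
  then have "AE x in lebesgue. indicator A x *\<^sub>R k x = indicator S x *\<^sub>R k x"
    by eventually_elim (auto simp: S(1) indicator_def)
  then have "(LINT x:A|lebesgue. k x) = (LINT x:S|lebesgue. k x)"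
    unfolding set_lebesgue_integral_def
    by (intro Bochner_Integration.integral_cong_AE borel_measurable_integrable integrable_mult_indicator k A)
      (use S(2) in \<open>auto intro: sets_completionI_sets\<close>)
  also have "\<dots> = 0" using S(2) by (intro borel) simp
  finally show "(LINT x:A|lebesgue. k x) = 0" .
qed

text \<open>Bump functions converge boundedly to indicator functions of intervals, so that the integral of \<open>k\<close> over
  every interval vanishes.\<close>

lemma fundamental_lemma:
  assumes k: "k \<in> L2" and zero: "\<And>\<psi>. test_function \<psi> \<Longrightarrow> L2_inner k \<psi> = 0"
  shows "AE x in unit_measure. k x = 0"
proof -
  have Ioo: "L2_inner k (indicator {p<..<q}) = 0" if "0 \<le> p" "q \<le> 1" for p q :: real
  proof -
    \<comment> \<open>The endpoints are moved inside, because test functions vanish near \<open>0\<close> and \<open>1\<close>.\<close>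
    define P Q where "P = (\<lambda>n. p + inverse (real (Suc n)))" and "Q = (\<lambda>n. q - inverse (real (Suc n)))"
    have PQ: "0 < P n" "Q n < 1" for n 
    proof -
      have "0 < inverse (real (Suc n))" by simp
      then show "0 < P n" "Q n < 1" using that unfolding P_def Q_def by linarith+
    qed
    have "(\<lambda>n. p + inverse (real (Suc n))) \<longlonglongrightarrow> p + 0" "(\<lambda>n. q - inverse (real (Suc n))) \<longlonglongrightarrow> q - 0"
      by (intro tendsto_intros LIMSEQ_inverse_real_of_nat)+
    then have lim: "P \<longlonglongrightarrow> p" "Q \<longlonglongrightarrow> q" by (simp_all add: P_def Q_def)
    have meas: "bump (P n) (Q n) (real (Suc n)) \<in> borel_measurable unit_measure" for n
      using L2_continuous[OF test_function_continuous[OF test_function_bump[OF PQ, of "real (Suc n)"]]] L2_measurable by simp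
    have "(\<lambda>n. LINT x|unit_measure. k x * bump (P n) (Q n) (real (Suc n)) x) \<longlonglongrightarrow> (LINT x|unit_measure. k x * indicator {p<..<q} x)"
    proof (rule integral_dominated_convergence)
      show "(\<lambda>x. k x * indicator {p<..<q} x) \<in> borel_measurable unit_measure"
        by (intro borel_measurable_times L2_measurable k measurable_restrict_space1 borel_measurable_indicator) simp
      show "(\<lambda>x. k x * bump (P n) (Q n) (real (Suc n)) x) \<in> borel_measurable unit_measure" for n
        by (intro borel_measurable_times L2_measurable k meas)
      show "integrable unit_measure (\<lambda>x. \<bar>k x\<bar>)"
        using L2_integrable[OF k] by simp
      show "AE x in unit_measure. norm (k x * bump (P n) (Q n) (real (Suc n)) x) \<le> \<bar>k x\<bar>" for n
      proof (rule AE_I2)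
        fix x show "norm (k x * bump (P n) (Q n) (real (Suc n)) x) \<le> \<bar>k x\<bar>"
          using mult_left_mono[OF bump_le_1[of "real (Suc n)" "P n" "Q n" x], of "\<bar>k x\<bar>"] by (simp add: abs_mult)
      qed
      have "AE x in lebesgue. x \<noteq> p \<and> x \<noteq> q"
        by (intro AE_conjI AE_completion) (auto intro: AE_lborel_singleton)
      then have "AE x in lebesgue. x \<in> {0<..<1} \<longrightarrow> (\<lambda>n. k x * bump (P n) (Q n) (real (Suc n)) x) \<longlonglongrightarrow> k x * indicator {p<..<q} x"
        by eventually_elim (intro impI tendsto_intros bump_tendsto_indicator lim; simp)
      then show "AE x in unit_measure. (\<lambda>n. k x * bump (P n) (Q n) (real (Suc n)) x) \<longlonglongrightarrow> k x * indicator {p<..<q} x"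
        by (simp add: AE_restrict_space_iff)
    qed
    moreover have "(LINT x|unit_measure. k x * bump (P n) (Q n) (real (Suc n)) x) = 0" for n
      using zero[OF test_function_bump[OF PQ, of "real (Suc n)"]] by (simp add: L2_inner_def)
    ultimately show ?thesis by (simp add: L2_inner_def LIMSEQ_const_iff)
  qed
  define K where "K = (\<lambda>x. indicator {0<..<1} x * k x)"
  have K: "integrable lebesgue K"
    using L2_integrable[OF k] by (simp add: integrable_restrict_space K_def)
  have LINT_K: "(LINT x|lebesgue. K x) = (LINT x|unit_measure. k x)"
    by (simp add: integral_restrict_space K_def)
  have "AE x in lebesgue. K x = 0"
  proof (rule AE_zero_if_integral_intervals_zero[OF K])
    have "(LINT x|unit_measure. k x) = L2_inner k (indicator {0<..<1})"
      unfolding L2_inner_def by (rule Bochner_Integration.integral_cong) auto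
    then show "(LINT x|lebesgue. K x) = 0" using Ioo[of 0 1] LINT_K by simp
    fix p q :: real assume "p \<le> q"
    have "(LINT x:{p..q}|lebesgue. K x) = (LINT x|lebesgue. indicator {0<..<1} x *\<^sub>R (k x * indicator {max 0 p<..<min 1 q} x))"
      unfolding set_lebesgue_integral_def
    proof (rule Bochner_Integration.integral_cong_AE)
      have "AE x in lebesgue. x \<noteq> p \<and> x \<noteq> q"
        by (intro AE_conjI AE_completion) (auto intro: AE_lborel_singleton)
      then show "AE x in lebesgue. indicator {p..q} x *\<^sub>R K x = indicator {0<..<1} x *\<^sub>R (k x * indicator {max 0 p<..<min 1 q} x)"
        by eventually_elim (auto simp: K_def indicator_def)
      show "(\<lambda>x. indicator {p..q} x *\<^sub>R K x) \<in> borel_measurable lebesgue"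
        by (intro borel_measurable_integrable integrable_mult_indicator K) simp
      have "(\<lambda>x. indicator {max 0 p<..<min 1 q} x *\<^sub>R K x) \<in> borel_measurable lebesgue"
        by (intro borel_measurable_integrable integrable_mult_indicator K) simp
      then show "(\<lambda>x. indicator {0<..<1} x *\<^sub>R (k x * indicator {max 0 p<..<min 1 q} x)) \<in> borel_measurable lebesgue"
        by (simp add: K_def ac_simps)
    qed
    also have "\<dots> = L2_inner k (indicator {max 0 p<..<min 1 q})"
      by (simp add: L2_inner_def integral_restrict_space)
    also have "\<dots> = 0" by (rule Ioo) auto
    finally show "(LINT x:{p..q}|lebesgue. K x) = 0" .
  qed
  then have "AE x in lebesgue. x \<in> {0<..<1} \<longrightarrow> k x = 0"
    by eventually_elim (simp add: K_def indicator_def)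
  then show ?thesis by (simp add: AE_restrict_space_iff)
qed

section \<open>Weak derivatives\<close>

lemma L2_indefinite_integral_continuous:
  "f \<in> L2 \<Longrightarrow> continuous_on {0..1} (\<lambda>x. integral {0..x} f)"
  by (intro indefinite_integral_continuous_1 L2_integrable_on) auto

text \<open>The lemma of du Bois-Reymond. The difference \<open>k\<close> of \<open>g\<close> and the indefinite integral of \<open>h\<close> is orthogonal to
  the derivative of every test function, that is, to every test function of mean zero. Subtracting from an
  arbitrary test function the multiple of a fixed bump \<open>\<psi>0\<close> with the same mean shows that \<open>k\<close> acts on test
  functions as a constant does.\<close>

lemma has_weak_derivative_1_primitive:
  assumes "has_weak_derivative 1 g h"
  obtains C where "AE x in unit_measure. g x = C + integral {0..x} h"
proof -
  have g: "g \<in> L2" and h: "h \<in> L2"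
    and weak: "\<And>\<phi>. test_function \<phi> \<Longrightarrow> L2_inner g (deriv \<phi>) = - L2_inner h \<phi>"
    using assms by (auto simp: has_weak_derivative_def L2_inner_def)
  define H where "H = (\<lambda>x. integral {0..x} h)"
  have H: "H \<in> L2"
    unfolding H_def by (intro L2_continuous L2_indefinite_integral_continuous h)
  have k: "(\<lambda>x. g x - H x) \<in> L2" using g H by (rule L2_diff)
  have orth: "L2_inner (\<lambda>x. g x - H x) (deriv \<phi>) = 0" if \<phi>: "test_function \<phi>" for \<phi>
  proof -
    note \<phi>' = test_function_deriv[OF \<phi>]
    have "L2_inner h \<phi> + L2_inner H (deriv \<phi>) = integral {0..1} h * \<phi> 1"
      unfolding H_def
      by (rule integration_by_parts_L2[OF h test_function_continuous[OF \<phi>']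
            has_field_derivative_at_within[OF test_function_DERIV[OF \<phi>]]])
    moreover have "\<phi> 1 = 0" using \<phi> by (auto simp: test_function_def)
    ultimately show ?thesis
      using weak[OF \<phi>] L2_continuous[OF test_function_continuous[OF \<phi>']] g H
      by (simp add: L2_inner_linear)
  qed
  define \<psi>0 where "\<psi>0 = bump (1/4) (3/4) 1"
  have \<psi>0: "test_function \<psi>0" unfolding \<psi>0_def by (rule test_function_bump) auto
  have mass: "integral {0..1} \<psi>0 \<noteq> 0"
  proof
    assume "integral {0..1} \<psi>0 = 0"
    moreover have "0 \<le> \<psi>0 x" for x by (simp add: \<psi>0_def bump_def flat_def)
    ultimately have "\<psi>0 (1/2) = 0"
      using integral_eq_0_iff[of 0 1 \<psi>0] test_function_continuous[OF \<psi>0] by auto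
    then show False by (simp add: \<psi>0_def bump_inside)
  qed
  define C where "C = L2_inner (\<lambda>x. g x - H x) \<psi>0 / integral {0..1} \<psi>0"
  have "AE x in unit_measure. g x - H x - C = 0"
  proof (rule fundamental_lemma)
    show "(\<lambda>x. g x - H x - C) \<in> L2"
      by (intro L2_diff g H L2_continuous) simp
    fix \<psi> assume \<psi>: "test_function \<psi>"
    have c: "continuous_on {0..1} \<psi>" "continuous_on {0..1} \<psi>0"
      using \<psi> \<psi>0 test_function_continuous by blast+
    have l: "\<psi> \<in> L2" "\<psi>0 \<in> L2" "(\<lambda>_. C) \<in> L2" using c by (auto intro: L2_continuous)
    define r where "r = - integral {0..1} \<psi> / integral {0..1} \<psi>0"
    have "integral {0..1} (\<lambda>x. 1 * \<psi> x + r * \<psi>0 x) = integral {0..1} \<psi> + r * integral {0..1} \<psi>0"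
      using c by (subst Henstock_Kurzweil_Integration.integral_add) (auto intro!: integrable_continuous_real continuous_intros)
    then have "integral {0..1} (\<lambda>x. 1 * \<psi> x + r * \<psi>0 x) = 0"
      using mass by (simp add: r_def)
    from test_function_antiderivative[OF test_function_lincomb[OF \<psi> \<psi>0] this]
    obtain \<phi> where \<phi>: "test_function \<phi>" "deriv \<phi> = (\<lambda>x. 1 * \<psi> x + r * \<psi>0 x)" .
    have "0 = L2_inner (\<lambda>x. g x - H x) (\<lambda>x. 1 * \<psi> x + r * \<psi>0 x)"
      using orth[OF \<phi>(1)] \<phi>(2) by simp
    also have "\<dots> = L2_inner (\<lambda>x. g x - H x) \<psi> + r * L2_inner (\<lambda>x. g x - H x) \<psi>0"
      using l k by (simp add: L2_inner_add_right L2_cmult L2_inner_cmult_right)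
    also have "\<dots> = L2_inner (\<lambda>x. g x - H x) \<psi> - C * integral {0..1} \<psi>"
      by (simp add: C_def r_def)
    also have "C * integral {0..1} \<psi> = L2_inner (\<lambda>_. C) \<psi>"
      using c by (simp add: L2_inner_continuous)
    finally show "L2_inner (\<lambda>x. g x - H x - C) \<psi> = 0"
      using l k by (simp add: L2_inner_diff_left)
  qed
  then have "AE x in unit_measure. g x = C + integral {0..x} h"
    by eventually_elim (simp add: H_def)
  then show ?thesis by (rule that)
qed

lemma continuous_AE_eq:
  assumes f: "continuous_on {0..1} f" and g: "continuous_on {0..1} g"
    and ae: "AE x in unit_measure. f x = g x" and x: "x \<in> {0..1}"
  shows "f x = (g x :: real)"
proof -
  have c: "continuous_on {0..1} (\<lambda>x. (f x - g x)\<^sup>2)" by (intro continuous_intros f g)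
  have "AE x in unit_measure. (f x - g x)\<^sup>2 = 0" using ae by eventually_elim simp
  then have "(LINT x|unit_measure. (f x - g x)\<^sup>2) = 0" by (rule integral_eq_zero_AE)
  then have "integral {0..1} (\<lambda>x. (f x - g x)\<^sup>2) = 0"
    using LINT_unit_measure[OF integrable_unit_measure_continuous[OF c]] by simp
  then have "(f x - g x)\<^sup>2 = 0"
    using integral_eq_0_iff[OF c] x by auto
  then show ?thesis by simp
qed

text \<open>The second weak derivative is the weak derivative of the first one: test the definition of the first
  with the derivative of a test function.\<close>

lemma H2_weak_derivs:
  assumes "\<theta> \<in> H2"
  shows "has_weak_derivative 1 \<theta> (weak_deriv 1 \<theta>)" "has_weak_derivative 1 (weak_deriv 1 \<theta>) (weak_deriv 2 \<theta>)"
proof -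
  have ex: "\<exists>w. has_weak_derivative n \<theta> w" if "n \<in> {1, 2}" for n
    using assms that unfolding H2_def by blast
  have 1: "has_weak_derivative 1 \<theta> (weak_deriv 1 \<theta>)" and 2: "has_weak_derivative 2 \<theta> (weak_deriv 2 \<theta>)"
    unfolding weak_deriv_def by (rule someI_ex[OF ex]; simp)+
  show "has_weak_derivative 1 \<theta> (weak_deriv 1 \<theta>)" by (rule 1)
  show "has_weak_derivative 1 (weak_deriv 1 \<theta>) (weak_deriv 2 \<theta>)"
    unfolding has_weak_derivative_def
  proof (intro conjI allI impI)
    fix \<phi> assume \<phi>: "test_function \<phi>"
    have "(LINT x|unit_measure. \<theta> x * deriv (deriv \<phi>) x) = - (LINT x|unit_measure. weak_deriv 1 \<theta> x * deriv \<phi> x)"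
      using 1 test_function_deriv[OF \<phi>] by (simp add: has_weak_derivative_def)
    moreover have "(LINT x|unit_measure. \<theta> x * deriv (deriv \<phi>) x) = (LINT x|unit_measure. weak_deriv 2 \<theta> x * \<phi> x)"
      using 2 \<phi> by (simp add: has_weak_derivative_def numeral_2_eq_2)
    ultimately show "(LINT x|unit_measure. weak_deriv 1 \<theta> x * (deriv ^^ 1) \<phi> x) = (- 1) ^ 1 * (LINT x|unit_measure. weak_deriv 2 \<theta> x * \<phi> x)"
      by simp
  qed (use 1 2 in \<open>auto simp: has_weak_derivative_def\<close>)
qed

locale H2_Dirichlet =
  fixes \<theta> :: "real \<Rightarrow> real"
  assumes H2: "\<theta> \<in> H2" and cont: "continuous_on {0..1} \<theta>" and bc: "\<theta> 0 = 0" "\<theta> 1 = 0"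
begin

abbreviation "\<theta>x \<equiv> weak_deriv 1 \<theta>"
abbreviation "\<theta>xx \<equiv> weak_deriv 2 \<theta>"

lemma L2: "\<theta> \<in> L2" "\<theta>x \<in> L2" "\<theta>xx \<in> L2"
  using H2_weak_derivs[OF H2] by (auto simp: has_weak_derivative_def)

lemma primitive:
  assumes "x \<in> {0..1}"
  shows "\<theta> x = integral {0..x} \<theta>x"
proof -
  obtain C where C: "AE x in unit_measure. \<theta> x = C + integral {0..x} \<theta>x"
    using has_weak_derivative_1_primitive[OF H2_weak_derivs(1)[OF H2]] .
  have "\<theta> x = C + integral {0..x} \<theta>x" if "x \<in> {0..1}" for x
    by (rule continuous_AE_eq[OF cont _ C that])
      (intro continuous_intros L2_indefinite_integral_continuous L2)
  from this[OF assms] this[of 0] show ?thesis using bc by simp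
qed

lemma by_parts:
  assumes v': "continuous_on {0..1} v'"
    and v: "\<And>x. x \<in> {0..1} \<Longrightarrow> (v has_real_derivative v' x) (at x within {0..1})"
  shows "L2_inner v \<theta>x = - L2_inner \<theta> v'"
proof -
  have "L2_inner (\<lambda>x. integral {0..x} \<theta>x) v' = L2_inner \<theta> v'"
    unfolding L2_inner_def by (rule Bochner_Integration.integral_cong) (auto simp: primitive)
  then show ?thesis
    using integration_by_parts_L2[OF L2(2) v' v] primitive[of 1] bc L2_inner_commute[of v] by simp
qed

text \<open>The continuous representative \<open>G\<close> of the weak derivative of \<open>\<theta>\<close> is \<open>C\<close> plus the indefinite integral
  \<open>H\<close> of the second derivative. Integration by parts gives \<open>\<langle>\<theta>, \<theta>xx\<rangle> = - \<langle>H, G\<rangle>\<close>, and replacing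
  \<open>H\<close> by \<open>G = C + H\<close> changes nothing, because \<open>G\<close> has mean \<open>\<theta> 1 - \<theta> 0 = 0\<close>.\<close>

lemma inner_second_deriv: "L2_inner \<theta> \<theta>xx = - L2_inner \<theta>x \<theta>x"
proof -
  define H where "H = (\<lambda>x. integral {0..x} \<theta>xx)"
  obtain C where C: "AE x in unit_measure. \<theta>x x = C + H x"
    unfolding H_def using has_weak_derivative_1_primitive[OF H2_weak_derivs(2)[OF H2]] .
  have H_cont: "continuous_on {0..1} H"
    unfolding H_def by (intro L2_indefinite_integral_continuous L2)
  define G where "G x = C + H x" for x
  have G_cont: "continuous_on {0..1} G" unfolding G_def by (intro continuous_intros H_cont)
  have GL2: "G \<in> L2" by (rule L2_continuous[OF G_cont])
  have \<theta>_int: "\<theta> x = integral {0..x} G" if x: "x \<in> {0..1}" for x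
  proof -
    have "AE z in lebesgue. z \<in> {0<..<1} \<longrightarrow> \<theta>x z = G z"
      using C by (simp add: AE_restrict_space_iff G_def)
    then obtain N where N: "N \<in> null_sets lebesgue" "\<And>z. z \<in> {0<..<1} \<Longrightarrow> z \<notin> N \<Longrightarrow> \<theta>x z = G z"
      by (auto elim!: AE_E3)
    have "negligible (insert 0 (insert 1 N))" using N(1) by (simp add: negligible_iff_null_sets)
    then have "integral {0..x} \<theta>x = integral {0..x} G"
    proof (rule integral_spike)
      fix z assume "z \<in> {0..x} - insert 0 (insert 1 N)"
      then show "G z = \<theta>x z" using N(2)[of z] x by auto
    qed
    then show ?thesis using primitive[OF x] by simp
  qed
  have d: "(\<theta> has_real_derivative G x) (at x within {0..1})" if "x \<in> {0..1}" for x
    by (rule has_field_derivative_transform_within[OF integral_has_real_derivative[OF G_cont that] zero_less_one that])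
      (simp add: \<theta>_int)
  have "L2_inner \<theta>xx \<theta> + L2_inner H G = 0"
    using integration_by_parts_L2[OF L2(3) G_cont d] bc by (simp add: H_def)
  moreover have "L2_inner G G = C * L2_inner (\<lambda>_. 1) G + L2_inner H G"
  proof -
    have "L2_inner (\<lambda>x. C * 1 + H x) G = C * L2_inner (\<lambda>_. 1) G + L2_inner H G"
      by (subst L2_inner_add_left) (auto intro!: L2_continuous H_cont GL2 simp: L2_inner_cmult_left[of C "\<lambda>_. 1" G, simplified])
    then show ?thesis unfolding G_def[abs_def] by simp
  qed
  moreover have "L2_inner (\<lambda>_. 1) G = 0"
    using \<theta>_int[of 1] bc G_cont by (simp add: L2_inner_continuous)
  moreover have "L2_inner \<theta>x \<theta>x = L2_inner G G"
    using L2_inner_cong_AE[of \<theta>x G G] L2_inner_cong_AE[of \<theta>x G \<theta>x] C L2(2) GL2 L2_inner_commute[of G \<theta>x]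
    by (simp add: G_def)
  ultimately show ?thesis by (simp add: L2_inner_commute)
qed

lemma Poincare: "L2_inner \<theta> \<theta> \<le> L2_inner \<theta>x \<theta>x"
proof -
  have "L2_norm \<theta> \<le> L2_norm \<theta>x"
    by (rule L2_norm_bounded[OF L2(1) _ L2_norm_nonneg])
      (use primitive abs_integral_le_L2_norm[OF L2(2)] in auto)
  then show ?thesis using L2_norm_nonneg by (simp flip: L2_norm_square)
qed

end

section \<open>Functions of class $C^1$ and $C^2$ on the strip\<close>

lemma C_class_continuous: "f \<in> C_class n A \<Longrightarrow> continuous_on A f"
  by (cases n) auto

lemma C_class_partial_ext: "f \<in> C_class (Suc n) A \<Longrightarrow> e \<in> Basis \<Longrightarrow> partial_ext A e f \<in> C_class n A"
  by simp

lemma C_class_SucD: "f \<in> C_class (Suc n) A \<Longrightarrow> f \<in> C_class n A"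
  by (induction n arbitrary: f) (auto dest: C_class_continuous)

lemma Basis_plane: "(1, 0) \<in> (Basis :: (real \<times> real) set)" "(0, 1) \<in> (Basis :: (real \<times> real) set)"
  by (auto simp: Basis_prod_def)

lemma interior_strip: "interior strip = {0<..} \<times> {0<..<1}"
  by (simp add: strip_def interior_Times interior_real_atLeast)

lemma continuous_on_strip_profile:
  assumes "continuous_on strip w" "0 \<le> t"
  shows "continuous_on {0..1} (\<lambda>x. w (t, x))"
  by (rule continuous_on_compose2[OF assms(1)]) (use assms(2) in \<open>auto intro!: continuous_intros simp: strip_def\<close>)

lemma continuous_on_strip_trace:
  assumes "continuous_on strip w" "x \<in> {0..1}"
  shows "continuous_on {0..} (\<lambda>t. w (t, x))"
  by (rule continuous_on_compose2[OF assms(1)]) (use assms(2) in \<open>auto intro!: continuous_intros simp: strip_def\<close>)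

locale C1_strip =
  fixes w :: "real \<times> real \<Rightarrow> real"
  assumes C1: "w \<in> C_class 1 strip"
begin

lemma continuous: "continuous_on strip w" "continuous_on strip (dt w)" "continuous_on strip (dx w)"
  using C1 Basis_plane by auto

lemma partial_derivative:
  assumes "e \<in> Basis" "z \<in> interior strip"
  shows "((\<lambda>h. w (z + h *\<^sub>R e)) has_real_derivative partial_ext strip e w z) (at 0)"
  using C1 assms by (simp add: partial_ext_def DERIV_deriv_iff_real_differentiable)

lemma dx_interior:
  assumes "0 < t" "x \<in> {0<..<1}"
  shows "((\<lambda>y. w (t, y)) has_real_derivative dx w (t, x)) (at x)"
proof -
  have "((\<lambda>h. w (t, h + x)) has_real_derivative dx w (t, x)) (at 0)"
    using partial_derivative[OF Basis_plane(2), of "(t, x)"] assms by (simp add: interior_strip add.commute)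
  then show ?thesis
    using DERIV_shift[of "\<lambda>y. w (t, y)" "dx w (t, x)" 0 x] by simp
qed

lemma dt_interior:
  assumes "0 < t" "x \<in> {0<..<1}"
  shows "((\<lambda>s. w (s, x)) has_real_derivative dt w (t, x)) (at t)"
proof -
  have "((\<lambda>h. w (h + t, x)) has_real_derivative dt w (t, x)) (at 0)"
    using partial_derivative[OF Basis_plane(1), of "(t, x)"] assms by (simp add: interior_strip add.commute)
  then show ?thesis
    using DERIV_shift[of "\<lambda>s. w (s, x)" "dt w (t, x)" 0 t] by simp
qed

lemma integral_dx:
  assumes "0 < t" "0 \<le> x" "x \<le> y" "y \<le> 1"
  shows "integral {x..y} (\<lambda>z. dx w (t, z)) = w (t, y) - w (t, x)"
proof (rule integral_unique[OF fundamental_theorem_of_calculus_interior])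
  show "continuous_on {x..y} (\<lambda>z. w (t, z))"
    by (rule continuous_on_subset[OF continuous_on_strip_profile[OF continuous(1)]]) (use assms in auto)
  show "((\<lambda>z. w (t, z)) has_vector_derivative dx w (t, z)) (at z)" if "z \<in> {x<..<y}" for z
    unfolding has_real_derivative_iff_has_vector_derivative[symmetric]
    by (rule dx_interior) (use that assms in auto)
qed (use assms in auto)

lemma dx_within:
  assumes t: "0 < t" and x: "x \<in> {0..1}"
  shows "((\<lambda>y. w (t, y)) has_real_derivative dx w (t, x)) (at x within {0..1})"
proof -
  have "continuous_on {0..1} (\<lambda>z. dx w (t, z))"
    by (rule continuous_on_strip_profile[OF continuous(3)]) (use t in simp)
  from DERIV_add[OF integral_has_real_derivative[OF this x] DERIV_const[of "w (t, 0)"]]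
  have "((\<lambda>y. integral {0..y} (\<lambda>z. dx w (t, z)) + w (t, 0)) has_real_derivative dx w (t, x)) (at x within {0..1})"
    by simp
  then show ?thesis
    by (rule has_field_derivative_transform_within[OF _ zero_less_one x])
      (use integral_dx[OF t, of 0] in simp)
qed

text \<open>At interior \<open>x\<close> the mean value theorem turns the difference quotient into a value of the time derivative at
  a nearby time, and the time derivative is uniformly continuous on compact sets. Both sides are continuous
  in \<open>x\<close>, so the bound extends to \<open>x = 0\<close> and \<open>x = 1\<close>; hence the extended derivatives on the boundary are
  derivatives of the boundary traces.\<close>

lemma dt_uniform:
  assumes t: "0 < t" and "0 < \<epsilon>"
  obtains \<delta> where "0 < \<delta>" "\<And>s x. s \<noteq> t \<Longrightarrow> \<bar>s - t\<bar> < \<delta> \<Longrightarrow> x \<in> {0..1} \<Longrightarrow>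
      \<bar>(w (s, x) - w (t, x)) / (s - t) - dt w (t, x)\<bar> \<le> \<epsilon>"
proof -
  let ?K = "{t/2..2*t} \<times> {0..1}"
  have "continuous_on ?K (dt w)"
    by (rule continuous_on_subset[OF continuous(2)]) (use t in \<open>auto simp: strip_def\<close>)
  then have "uniformly_continuous_on ?K (dt w)"
    by (rule compact_uniformly_continuous) (intro compact_Times compact_Icc)
  then obtain d where d: "0 < d" "\<And>y z. y \<in> ?K \<Longrightarrow> z \<in> ?K \<Longrightarrow> dist z y < d \<Longrightarrow> dist (dt w z) (dt w y) < \<epsilon>"
    unfolding uniformly_continuous_on_def using \<open>0 < \<epsilon>\<close> by metis
  show ?thesis
  proof (rule that[of "min d (t/2)"])
    fix s x :: real assume s: "s \<noteq> t" "\<bar>s - t\<bar> < min d (t/2)" and x: "x \<in> {0..1}"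
    have s0: "0 < s" using s t by (auto simp: abs_if split: if_splits)
    have inner: "\<bar>(w (s, x) - w (t, x)) / (s - t) - dt w (t, x)\<bar> \<le> \<epsilon>" if x: "x \<in> {0<..<1}" for x
    proof -
      have "\<exists>\<xi>. min s t < \<xi> \<and> \<xi> < max s t \<and> w (max s t, x) - w (min s t, x) = (max s t - min s t) * dt w (\<xi>, x)"
        by (rule MVT2) (use s s0 t in \<open>auto intro!: dt_interior x\<close>)
      then obtain \<xi> where \<xi>: "min s t < \<xi>" "\<xi> < max s t"
        "w (max s t, x) - w (min s t, x) = (max s t - min s t) * dt w (\<xi>, x)" by blast
      have eq: "(w (s, x) - w (t, x)) / (s - t) = dt w (\<xi>, x)"
        using \<xi>(3) s(1) by (cases "s < t") (auto simp: field_simps)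
      have "\<bar>\<xi> - t\<bar> < min d (t/2)" using \<xi>(1,2) s(2) by linarith
      then have "dist (dt w (\<xi>, x)) (dt w (t, x)) < \<epsilon>"
        using t x by (intro d(2)) (auto simp: dist_prod_def dist_real_def abs_if split: if_splits)
      then show ?thesis by (simp add: eq dist_real_def)
    qed
    define q where "q = (\<lambda>x. \<bar>(w (s, x) - w (t, x)) / (s - t) - dt w (t, x)\<bar>)"
    have "continuous_on {0..1} q"
      using s0 t s(1) unfolding q_def by (auto intro!: continuous_intros continuous_on_strip_profile continuous)
    then have "q x \<le> \<epsilon>"
      using continuous_le_on_closure[of "{0<..<1}" q x \<epsilon>] x inner by (simp add: q_def)
    then show "\<bar>(w (s, x) - w (t, x)) / (s - t) - dt w (t, x)\<bar> \<le> \<epsilon>"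
      by (simp add: q_def)
  qed (use d t in auto)
qed

lemma dt_at:
  assumes "0 < t" "x \<in> {0..1}"
  shows "((\<lambda>s. w (s, x)) has_real_derivative dt w (t, x)) (at t)"
  unfolding has_field_derivative_iff
proof (rule LIM_I)
  fix r :: real assume "0 < r"
  then obtain \<delta> where "0 < \<delta>" "\<And>s x. s \<noteq> t \<Longrightarrow> \<bar>s - t\<bar> < \<delta> \<Longrightarrow> x \<in> {0..1} \<Longrightarrow>
      \<bar>(w (s, x) - w (t, x)) / (s - t) - dt w (t, x)\<bar> \<le> r / 2"
    using dt_uniform[OF assms(1), of "r/2"] by (metis half_gt_zero)
  with assms(2) \<open>0 < r\<close> show "\<exists>\<delta>>0. \<forall>s. s \<noteq> t \<and> norm (s - t) < \<delta> \<longrightarrow> norm ((w (s, x) - w (t, x)) / (s - t) - dt w (t, x)) < r"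
    by (intro exI[of _ \<delta>]) fastforce
qed

lemma has_L2_derivative:
  assumes t: "0 < t"
  shows "has_L2_derivative (curry w) (curry (dt w) t) t"
proof -
  have mem: "curry (dt w) t \<in> L2"
    unfolding curry_def by (intro L2_continuous continuous_on_strip_profile continuous) (use t in simp)
  have "((\<lambda>s. L2_norm (\<lambda>x. (curry w s x - curry w t x) / (s - t) - curry (dt w) t x)) \<longlongrightarrow> 0) (at t)"
  proof (rule LIM_I)
    fix r :: real assume "0 < r"
    then obtain \<delta> where \<delta>: "0 < \<delta>" "\<And>s x. s \<noteq> t \<Longrightarrow> \<bar>s - t\<bar> < \<delta> \<Longrightarrow> x \<in> {0..1} \<Longrightarrow>
        \<bar>(w (s, x) - w (t, x)) / (s - t) - dt w (t, x)\<bar> \<le> r / 2"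
      using dt_uniform[OF t, of "r/2"] by (metis half_gt_zero)
    show "\<exists>\<delta>>0. \<forall>s. s \<noteq> t \<and> norm (s - t) < \<delta> \<longrightarrow>
        norm (L2_norm (\<lambda>x. (curry w s x - curry w t x) / (s - t) - curry (dt w) t x) - 0) < r"
    proof (intro exI[of _ "min \<delta> t"] conjI allI impI)
      fix s assume s: "s \<noteq> t \<and> norm (s - t) < min \<delta> t"
      then have s0: "0 \<le> s" by (auto simp: abs_if split: if_splits)
      have "L2_norm (\<lambda>x. (curry w s x - curry w t x) / (s - t) - curry (dt w) t x) \<le> r / 2"
      proof (rule L2_norm_bounded)
        show "(\<lambda>x. (curry w s x - curry w t x) / (s - t) - curry (dt w) t x) \<in> L2"
          using s s0 t by (auto simp: curry_def intro!: L2_continuous continuous_intros continuous_on_strip_profile continuous)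
      qed (use s \<delta>(2)[of s] \<open>0 < r\<close> in auto)
      then show "norm (L2_norm (\<lambda>x. (curry w s x - curry w t x) / (s - t) - curry (dt w) t x) - 0) < r"
        using \<open>0 < r\<close> by (simp add: L2_norm_nonneg)
    qed (use \<delta> t in auto)
  qed
  then show ?thesis using mem by (simp add: has_L2_derivative_def)
qed

end

locale C2_strip =
  fixes u :: "real \<times> real \<Rightarrow> real"
  assumes C2: "u \<in> C_class 2 strip"
begin

sublocale u: C1_strip u
  using C2 C_class_SucD[of u 1] by unfold_locales (simp add: numeral_2_eq_2)

sublocale ut: C1_strip "dt u"
  using C2 C_class_partial_ext[OF _ Basis_plane(1), of u 1] by unfold_locales (simp add: numeral_2_eq_2 del: C_class.simps)

sublocale ux: C1_strip "dx u"
  using C2 C_class_partial_ext[OF _ Basis_plane(2), of u 1] by unfold_locales (simp add: numeral_2_eq_2 del: C_class.simps)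

text \<open>Differentiation under the integral in \<open>u (t, x) = \<integral> dx u\<close>. This says that the mixed derivatives commute and
  gives the Dirichlet condition for the velocity.\<close>

lemma dt_eq_integral_dt_dx:
  assumes bc: "\<And>t. 0 < t \<Longrightarrow> u (t, 0) = 0" and t: "0 < t" and x: "x \<in> {0..1}"
  shows "dt u (t, x) = integral {0..x} (\<lambda>y. dt (dx u) (t, y))"
proof -
  have "((\<lambda>s. integral (cbox 0 x) (\<lambda>y. dx u (s, y))) has_real_derivative integral (cbox 0 x) (\<lambda>y. dt (dx u) (t, y))) (at t within {0<..})"
  proof (rule leibniz_rule_field_derivative)
    show "((\<lambda>s. dx u (s, y)) has_real_derivative dt (dx u) (s, y)) (at s within {0<..})"
      if "s \<in> {0<..}" "y \<in> cbox 0 x" for s y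
      by (rule has_field_derivative_at_within[OF ux.dt_at]) (use that x in auto)
    show "(\<lambda>y. dx u (s, y)) integrable_on cbox 0 x" if "s \<in> {0<..}" for s
      unfolding cbox_interval
      by (intro integrable_continuous_real continuous_on_subset[OF continuous_on_strip_profile[OF ux.continuous(1)]])
        (use that x in auto)
    have "continuous_on ({0<..} \<times> cbox 0 x) (dt (dx u))"
      by (rule continuous_on_subset[OF ux.continuous(2)]) (use x in \<open>auto simp: strip_def\<close>)
    then show "continuous_on ({0<..} \<times> cbox 0 x) (\<lambda>(s, y). dt (dx u) (s, y))" by simp
  qed (use t in auto)
  then have "((\<lambda>s. integral {0..x} (\<lambda>y. dx u (s, y))) has_real_derivative integral {0..x} (\<lambda>y. dt (dx u) (t, y))) (at t)"
    using t by (simp add: at_within_open[of t "{0<..}"])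
  then have "((\<lambda>s. u (s, x)) has_real_derivative integral {0..x} (\<lambda>y. dt (dx u) (t, y))) (at t)"
    by (rule has_field_derivative_transform_within_open[where S = "{0<..}"])
      (use t x bc u.integral_dx[of _ 0 x] in auto)
  then show ?thesis
    using u.dt_at[OF t x] by (rule DERIV_unique[OF _ , symmetric])
qed

lemma dt_within:
  assumes bc: "\<And>t. 0 < t \<Longrightarrow> u (t, 0) = 0" and t: "0 < t" and x: "x \<in> {0..1}"
  shows "((\<lambda>y. dt u (t, y)) has_real_derivative dt (dx u) (t, x)) (at x within {0..1})"
proof -
  have "continuous_on {0..1} (\<lambda>z. dt (dx u) (t, z))"
    by (rule continuous_on_strip_profile[OF ux.continuous(2)]) (use t in simp)
  then have "((\<lambda>y. integral {0..y} (\<lambda>z. dt (dx u) (t, z))) has_real_derivative dt (dx u) (t, x)) (at x within {0..1})"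
    using x by (rule integral_has_real_derivative)
  then show ?thesis
    by (rule has_field_derivative_transform_within[OF _ zero_less_one x])
      (use dt_eq_integral_dt_dx[OF bc t] in simp)
qed

end

section \<open>Tools for the energy estimate\<close>

lemma L2_inner_by_parts:
  assumes f: "continuous_on {0..1} f" and g: "continuous_on {0..1} g"
    and F: "\<And>x. x \<in> {0..1} \<Longrightarrow> (F has_real_derivative f x) (at x within {0..1})"
    and G: "\<And>x. x \<in> {0..1} \<Longrightarrow> (G has_real_derivative g x) (at x within {0..1})"
  shows "L2_inner f G + L2_inner F g = F 1 * G 1 - F 0 * G 0"
proof -
  have Fc: "continuous_on {0..1} F" and Gc: "continuous_on {0..1} G"
    using DERIV_continuous_on[OF F] DERIV_continuous_on[OF G] by auto
  have "((\<lambda>x. f x * G x + g x * F x) has_integral (F 1 * G 1 - F 0 * G 0)) {0..1}"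
  proof (rule fundamental_theorem_of_calculus)
    fix x :: real assume "x \<in> {0..1}"
    from DERIV_mult[OF F[OF this] G[OF this]]
    show "((\<lambda>x. F x * G x) has_vector_derivative f x * G x + g x * F x) (at x within {0..1})"
      by (simp only: has_real_derivative_iff_has_vector_derivative)
  qed simp
  moreover have "integral {0..1} (\<lambda>x. f x * G x + g x * F x) = L2_inner f G + L2_inner F g"
    unfolding L2_inner_continuous[OF f Gc] L2_inner_continuous[OF Fc g]
    by (subst Henstock_Kurzweil_Integration.integral_add[symmetric])
      (auto intro!: integrable_continuous_real continuous_intros f g Fc Gc simp: mult.commute)
  ultimately show ?thesis by (metis integral_unique)
qed

lemma continuous_on_L2_inner_strip:
  assumes w: "continuous_on strip w"
  shows "continuous_on {0..} (\<lambda>t. L2_inner (curry w t) (curry w t))"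
proof -
  have "continuous_on strip (\<lambda>z. w z * w z)" by (intro continuous_intros w)
  then have "continuous_on ({0..} \<times> cbox 0 1) (\<lambda>(t, x). w (t, x) * w (t, x))"
    by (simp add: strip_def case_prod_unfold)
  then have "continuous_on {0..} (\<lambda>t. integral (cbox 0 1) (\<lambda>x. w (t, x) * w (t, x)))"
    by (rule integral_continuous_on_param)
  then show ?thesis
    by (rule continuous_on_eq)
      (simp add: curry_def L2_inner_continuous continuous_on_strip_profile[OF w])
qed

lemma Gronwall_decay:
  assumes "0 < r" "0 \<le> T" and cont: "continuous_on {0..T} V"
    and deriv: "\<And>t. 0 < t \<Longrightarrow> t < T \<Longrightarrow> \<exists>d. (V has_real_derivative d) (at t) \<and> d \<le> - r * V t + B"
  shows "V T \<le> exp (- r * T) * V 0 + B / r * (1 - exp (- r * T))"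
proof -
  define \<phi> where "\<phi> t = exp (r * t) * (V t - B / r)" for t
  have "\<phi> T \<le> \<phi> 0"
  proof (rule DERIV_nonpos_imp_decreasing_open[OF \<open>0 \<le> T\<close>])
    fix t assume "0 < t" "t < T"
    then obtain d where d: "(V has_real_derivative d) (at t)" "d \<le> - r * V t + B"
      using deriv by blast
    have "(\<phi> has_real_derivative exp (r * t) * (r * V t - B + d)) (at t)"
      unfolding \<phi>_def using \<open>0 < r\<close>
      by (auto intro!: derivative_eq_intros d(1) simp: field_simps)
    moreover have "exp (r * t) * (r * V t - B + d) \<le> 0"
      using d(2) by (intro mult_nonneg_nonpos) auto
    ultimately show "\<exists>y. (\<phi> has_real_derivative y) (at t) \<and> y \<le> 0" by blast
  next
    show "continuous_on {0..T} \<phi>"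
      unfolding \<phi>_def by (intro continuous_intros cont)
  qed
  then have "exp (- r * T) * \<phi> T \<le> exp (- r * T) * \<phi> 0"
    by (rule mult_left_mono) simp
  moreover have "exp (- r * T) * \<phi> T = V T - B / r"
    by (simp add: \<phi>_def mult.assoc[symmetric] exp_add[symmetric])
  ultimately show ?thesis by (simp add: \<phi>_def algebra_simps)
qed

section \<open>The constants\<close>

locale thermoelastic_coefficients =
  fixes a c \<mu> \<sigma> b k lam :: real
  assumes pos: "a > 0" "c > 0" "\<mu> \<ge> 0" "\<sigma> > 0" "b > 0" "k > 0" "lam > 0"
begin

text \<open>\<open>\<kappa>\<close> is the decay rate of \<open>w = u\<^sub>t - \<sigma> u\<^sub>x\<^sub>x\<close>. The forcing of \<open>w\<close> by \<open>u\<^sub>t\<close> and \<open>\<theta>\<^sub>x\<close> costs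
  \<open>\<epsilon> (3 / (2 \<kappa>)) (\<kappa> - \<mu>)\<^sup>2\<close> and \<open>\<epsilon> (3 / (2 \<kappa>)) b\<^sup>2\<close>; the choice of \<open>\<epsilon>\<close> keeps these below a quarter and a half of
  the corresponding dissipation coefficients \<open>\<sigma>\<close> and \<open>b k / lam\<close>. With \<open>D\<close> the sum of \<open>u\<^sub>t(t,1)\<^sup>2\<close>,
  \<open>|u\<^sub>x\<^sub>t|\<^sup>2\<close>, \<open>|\<theta>\<^sub>x|\<^sup>2\<close> and \<open>|w|\<^sup>2\<close>, the other constants satisfy \<open>V' \<le> - m D + K |f|\<^sup>2\<close>,
  \<open>V \<le> M D\<close>, and \<open>S \<le> C1 V\<close>, \<open>V \<le> C2 S\<close> for the square \<open>S\<close> of the state norm.\<close>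

definition "\<kappa> = c\<^sup>2 / \<sigma>"
definition "\<epsilon> = min (\<sigma> / 4) (b * k / (2 * lam)) / (3 / (2 * \<kappa>) * ((\<kappa> - \<mu>)\<^sup>2 + b\<^sup>2) + 1)"
definition "K = 1 / \<sigma> + 3 * \<epsilon> / (2 * \<kappa>)"
definition "m = min (min (a * c\<^sup>2) (\<sigma> / 2)) (min (b * k / (2 * lam)) (\<epsilon> * \<kappa> / 2))"
definition "M = 1/2 + a\<^sup>2 * c\<^sup>2 + 2 * c\<^sup>2 / \<sigma>\<^sup>2 + a * \<sigma> / 2 + b / (2 * lam) + \<epsilon> / 2"
definition "C1 = 2 + 2 / c\<^sup>2 + 2 / (a * \<sigma>) + 2 * lam / b + (4 + 4 / \<epsilon>) / \<sigma>\<^sup>2"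
definition "C2 = 1/2 + c\<^sup>2 / 2 + a * \<sigma> / 2 + b / (2 * lam) + \<epsilon> + \<epsilon> * \<sigma>\<^sup>2"

lemma \<kappa>_pos: "0 < \<kappa>" using pos by (simp add: \<kappa>_def)

lemma \<epsilon>_pos: "0 < \<epsilon>"
  unfolding \<epsilon>_def using pos \<kappa>_pos
  by (intro divide_pos_pos add_nonneg_pos mult_nonneg_nonneg) auto

lemma \<epsilon>_small: "\<epsilon> * (3 / (2 * \<kappa>)) * (\<kappa> - \<mu>)\<^sup>2 \<le> \<sigma> / 4" "\<epsilon> * (3 / (2 * \<kappa>)) * b\<^sup>2 \<le> b * k / (2 * lam)"
proof -
  define A B where "A = 3 / (2 * \<kappa>) * (\<kappa> - \<mu>)\<^sup>2" and "B = 3 / (2 * \<kappa>) * b\<^sup>2"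
  have AB: "0 \<le> A" "0 \<le> B" using \<kappa>_pos by (auto simp: A_def B_def)
  have "\<epsilon> = min (\<sigma> / 4) (b * k / (2 * lam)) / (A + B + 1)"
    by (simp only: \<epsilon>_def A_def B_def distrib_left)
  then have eq: "\<epsilon> * (A + B + 1) = min (\<sigma> / 4) (b * k / (2 * lam))"
    using AB by simp
  have "\<epsilon> * A \<le> \<epsilon> * (A + B + 1)" "\<epsilon> * B \<le> \<epsilon> * (A + B + 1)"
    using \<epsilon>_pos AB by (auto intro!: mult_left_mono)
  then have "\<epsilon> * A \<le> \<sigma> / 4" "\<epsilon> * B \<le> b * k / (2 * lam)"
    unfolding eq by auto
  then show "\<epsilon> * (3 / (2 * \<kappa>)) * (\<kappa> - \<mu>)\<^sup>2 \<le> \<sigma> / 4" "\<epsilon> * (3 / (2 * \<kappa>)) * b\<^sup>2 \<le> b * k / (2 * lam)"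
    by (simp_all only: A_def B_def mult.assoc)
qed

lemma constants_pos: "0 < K" "0 < m" "0 < M" "0 < C1" "0 < C2"
proof -
  show "0 < K" "0 < m" unfolding K_def m_def using pos \<kappa>_pos \<epsilon>_pos by (auto intro!: add_pos_pos)
  show "0 < M" "0 < C1" "0 < C2" unfolding M_def C1_def C2_def using pos \<kappa>_pos \<epsilon>_pos
    by (auto intro!: add_pos_pos add_pos_nonneg)
qed

end

section \<open>The Lyapunov functional\<close>

locale thermoelastic_solution = thermoelastic_coefficients a c \<mu> \<sigma> b k lam + C2_strip u
  for a c \<mu> \<sigma> b k lam :: real and u :: "real \<times> real \<Rightarrow> real" +
  fixes f \<theta> :: "real \<times> real \<Rightarrow> real"
  assumes f: "curry f \<in> C0_L2 {0..}"
    and \<theta>_cont: "continuous_on strip \<theta>" and \<theta>_C1: "curry \<theta> \<in> C1_L2 {0<..}"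
    and uxx_C1: "curry (dx (dx u)) \<in> C1_L2 {0<..}"
    and \<theta>_H2: "\<And>t. 0 < t \<Longrightarrow> curry \<theta> t \<in> H2"
    and wave: "\<And>t. 0 < t \<Longrightarrow> AE x in unit_measure.
          dt (dt u) (t, x) = c\<^sup>2 * dx (dx u) (t, x) + \<sigma> * L2_deriv (curry (dx (dx u))) t x
            - \<mu> * dt u (t, x) - b * weak_deriv 1 (curry \<theta> t) x + f (t, x)"
    and heat: "\<And>t. 0 < t \<Longrightarrow> AE x in unit_measure.
          L2_deriv (curry \<theta>) t x = k * weak_deriv 2 (curry \<theta> t) x - lam * dt (dx u) (t, x)"
    and u0: "\<And>t. 0 < t \<Longrightarrow> u (t, 0) = 0"
    and ux1: "\<And>t. 0 < t \<Longrightarrow> dx u (t, 1) = - a * dt u (t, 1)"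
    and \<theta>0: "\<And>t. 0 < t \<Longrightarrow> \<theta> (t, 0) = 0" and \<theta>1: "\<And>t. 0 < t \<Longrightarrow> \<theta> (t, 1) = 0"
begin

abbreviation "ut \<equiv> curry (dt u)"
abbreviation "ux \<equiv> curry (dx u)"
abbreviation "uxx \<equiv> curry (dx (dx u))"
abbreviation "utt \<equiv> curry (dt (dt u))"
abbreviation "uxt \<equiv> curry (dt (dx u))"
abbreviation "uxxt \<equiv> L2_deriv uxx"
abbreviation "\<theta>t \<equiv> L2_deriv (curry \<theta>)"
abbreviation "\<theta>x t \<equiv> weak_deriv 1 (curry \<theta> t)"
abbreviation "\<theta>xx t \<equiv> weak_deriv 2 (curry \<theta> t)"
text \<open>Its time derivative contains no \<open>u\<^sub>x\<^sub>x\<^sub>t\<close>, so that \<open>w\<close> is forced only by terms that the energy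
  dissipates, and by \<open>f\<close>.\<close>

definition "w t x = ut t x - \<sigma> * uxx t x"

definition "V t = 1 / 2 * L2_inner (ut t) (ut t) + c\<^sup>2 / 2 * L2_inner (ux t) (ux t) + a * \<sigma> / 2 * (dt u (t, 1))\<^sup>2
    + b / (2 * lam) * L2_inner (curry \<theta> t) (curry \<theta> t) + \<epsilon> / 2 * L2_inner (w t) (w t)"

lemma profile_continuous:
  assumes "0 \<le> t"
  shows "continuous_on {0..1} (ut t)" "continuous_on {0..1} (ux t)" "continuous_on {0..1} (uxx t)"
    "continuous_on {0..1} (utt t)" "continuous_on {0..1} (uxt t)" "continuous_on {0..1} (curry \<theta> t)"
  unfolding curry_def
  by (intro continuous_on_strip_profile[OF _ assms] u.continuous ut.continuous ux.continuous \<theta>_cont)+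

lemma profile_L2:
  assumes "0 \<le> t"
  shows "ut t \<in> L2" "ux t \<in> L2" "uxx t \<in> L2" "utt t \<in> L2" "uxt t \<in> L2" "curry \<theta> t \<in> L2" "w t \<in> L2" "curry f t \<in> L2"
proof -
  show *: "ut t \<in> L2" "ux t \<in> L2" "uxx t \<in> L2" "utt t \<in> L2" "uxt t \<in> L2" "curry \<theta> t \<in> L2"
    using profile_continuous[OF assms] by (auto intro: L2_continuous)
  show "w t \<in> L2" unfolding w_def[abs_def] by (intro L2_intros *)
  show "curry f t \<in> L2" using f assms by (simp add: C0_L2_def)
qed

lemma C1_L2_has_derivative:
  assumes "y \<in> C1_L2 {0<..}" "0 < t"
  shows "has_L2_derivative y (L2_deriv y t) t"
proof -
  have "\<exists>v. has_L2_derivative y v t" using assms by (simp add: C1_L2_def)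
  then show ?thesis unfolding L2_deriv_def by (rule someI_ex)
qed

lemma boundary_velocity:
  assumes "0 < t"
  shows "dt u (t, 0) = 0" "dt (dx u) (t, 1) = - a * dt (dt u) (t, 1)"
proof -
  show "dt u (t, 0) = 0" using dt_eq_integral_dt_dx[OF u0 assms, of 0] by simp
  have "((\<lambda>s. dx u (s, 1)) has_real_derivative - a * dt (dt u) (t, 1)) (at t)"
    by (rule has_field_derivative_transform_within_open[OF DERIV_cmult[OF ut.dt_at[OF assms, of 1]], where S = "{0<..}"])
      (use assms ux1 in auto)
  then show "dt (dx u) (t, 1) = - a * dt (dt u) (t, 1)"
    using ux.dt_at[OF assms, of 1] by (auto intro: DERIV_unique)
qed

lemma ut_uxx_by_parts:
  assumes t: "0 < t" and s: "0 < s"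
  shows "L2_inner (uxx s) (ut t) = dx u (s, 1) * dt u (t, 1) - L2_inner (ux s) (uxt t)"
proof -
  have "L2_inner (uxx s) (ut t) + L2_inner (ux s) (uxt t) = ux s 1 * ut t 1 - ux s 0 * ut t 0"
    by (rule L2_inner_by_parts) (use t s profile_continuous[of s] profile_continuous[of t] ux.dx_within[OF s] dt_within[OF u0 t] in \<open>auto simp: curry_def\<close>)
  then show ?thesis using boundary_velocity[OF t] by simp
qed

text \<open>In the previous identity the profile of \<open>u\<^sub>t\<close> at time \<open>t\<close> is held fixed while \<open>s\<close> varies. Both
  sides are differentiable in \<open>s\<close> at \<open>s = t\<close>, the left one because \<open>u\<^sub>x\<^sub>x\<close> is differentiable in \<open>L\<^sup>2\<close>.\<close>

lemma ut_uxxt_by_parts: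
  assumes t: "0 < t"
  shows "L2_inner (ut t) (uxxt t) = dt (dx u) (t, 1) * dt u (t, 1) - L2_inner (uxt t) (uxt t)"
proof -
  have "((\<lambda>s. L2_inner (uxx s) (ut t)) has_real_derivative L2_inner (uxxt t) (ut t)) (at t)"
    by (rule has_L2_derivative_inner[of "{0<..}"]) (use t profile_L2 C1_L2_has_derivative[OF uxx_C1 t] in auto)
  moreover have "((\<lambda>s. L2_inner (uxx s) (ut t)) has_real_derivative
      dt (dx u) (t, 1) * dt u (t, 1) - L2_inner (uxt t) (uxt t)) (at t)"
  proof (rule has_field_derivative_transform_within_open[where S = "{0<..}"])
    have "((\<lambda>s. L2_inner (ux s) (uxt t)) has_real_derivative L2_inner (uxt t) (uxt t)) (at t)"
      by (rule has_L2_derivative_inner[of "{0<..}"]) (use t profile_L2 ux.has_L2_derivative[OF t] in auto)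
    from DERIV_diff[OF DERIV_cmult_right[OF ux.dt_at[OF t, of 1], of "dt u (t, 1)"] this]
    show "((\<lambda>s. dx u (s, 1) * dt u (t, 1) - L2_inner (ux s) (uxt t)) has_real_derivative
        dt (dx u) (t, 1) * dt u (t, 1) - L2_inner (uxt t) (uxt t)) (at t)" by simp
  qed (use t ut_uxx_by_parts[OF t] in auto)
  ultimately show ?thesis using DERIV_unique by (subst L2_inner_commute) blast
qed

lemma \<theta>_Dirichlet: "0 < t \<Longrightarrow> H2_Dirichlet (curry \<theta> t)"
  by unfold_locales (use \<theta>_H2 \<theta>0 \<theta>1 profile_continuous(6) in auto)

lemma velocity_Poincare:
  assumes t: "0 < t"
  shows "L2_inner (ut t) (ut t) \<le> L2_inner (uxt t) (uxt t)"
proof -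
  have "L2_norm (ut t) \<le> L2_norm (uxt t)"
  proof (rule L2_norm_bounded[OF _ _ L2_norm_nonneg])
    fix x :: real assume x: "x \<in> {0<..<1}"
    have "\<bar>integral {0..x} (uxt t)\<bar> \<le> L2_norm (uxt t)"
      by (rule abs_integral_le_L2_norm) (use t x profile_L2 in auto)
    then show "\<bar>ut t x\<bar> \<le> L2_norm (uxt t)"
      using dt_eq_integral_dt_dx[OF u0 t, of x] x by (simp add: curry_def)
  qed (use t profile_L2 in auto)
  then show ?thesis using L2_norm_nonneg by (simp flip: L2_norm_square)
qed

text \<open>Integrate \<open>u\<^sub>x\<^sub>x\<close> back from the damped end, where \<open>u\<^sub>x = - a u\<^sub>t\<close>.\<close>

lemma strain_bound:
  assumes t: "0 < t"
  shows "L2_inner (ux t) (ux t) \<le> 2 * a\<^sup>2 * (dt u (t, 1))\<^sup>2 + 2 * L2_inner (uxx t) (uxx t)"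
proof -
  have "L2_norm (ux t) \<le> \<bar>a * dt u (t, 1)\<bar> + L2_norm (uxx t)"
  proof (rule L2_norm_bounded)
    fix x :: real assume x: "x \<in> {0<..<1}"
    have "\<bar>integral {x..1} (uxx t)\<bar> \<le> L2_norm (uxx t)"
      by (rule abs_integral_le_L2_norm) (use t x profile_L2 in auto)
    then show "\<bar>ux t x\<bar> \<le> \<bar>a * dt u (t, 1)\<bar> + L2_norm (uxx t)"
      using ux.integral_dx[OF t, of x 1] x ux1[OF t] by (simp add: curry_def)
  qed (use t profile_L2 L2_norm_nonneg in auto)
  then have "(L2_norm (ux t))\<^sup>2 \<le> (\<bar>a * dt u (t, 1)\<bar> + L2_norm (uxx t))\<^sup>2"
    by (intro power_mono L2_norm_nonneg)
  also have "\<dots> \<le> 2 * \<bar>a * dt u (t, 1)\<bar>\<^sup>2 + 2 * (L2_norm (uxx t))\<^sup>2"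
    using sum_squares_bound[of "\<bar>a * dt u (t, 1)\<bar>" "L2_norm (uxx t)"] by (simp add: power2_sum)
  finally show ?thesis by (simp add: L2_norm_square power_mult_distrib)
qed

text \<open>The right-hand side is what is left after three cancellations: of \<open>\<langle>u\<^sub>x, u\<^sub>x\<^sub>t\<rangle>\<close> by integrating
  \<open>u\<^sub>x\<^sub>x\<close> by parts, of the boundary product \<open>u\<^sub>t u\<^sub>t\<^sub>t\<close> at \<open>x = 1\<close> by the boundary term of \<open>V\<close>, and of the
  thermal coupling by the weight \<open>b / (2 lam)\<close>.\<close>

lemma V_derivative:
  assumes t: "0 < t"
  shows "(V has_real_derivative
      (- a * c\<^sup>2 * (dt u (t, 1))\<^sup>2 - \<sigma> * L2_inner (uxt t) (uxt t) - \<mu> * L2_inner (ut t) (ut t)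
       - b * k / lam * L2_inner (\<theta>x t) (\<theta>x t) + L2_inner (ut t) (curry f t)
       + \<epsilon> * (- \<kappa> * L2_inner (w t) (w t) + (\<kappa> - \<mu>) * L2_inner (w t) (ut t)
           - b * L2_inner (w t) (\<theta>x t) + L2_inner (w t) (curry f t)))) (at t)"
proof -
  note [simp del] = curry_conv One_nat_def
  interpret \<theta>: H2_Dirichlet "curry \<theta> t" by (rule \<theta>_Dirichlet[OF t])
  note L2 = profile_L2[of t]
  have uxxt: "uxxt t \<in> L2" and \<theta>t: "\<theta>t t \<in> L2"
    using C1_L2_has_derivative[OF uxx_C1 t] C1_L2_has_derivative[OF \<theta>_C1 t] by (auto simp: has_L2_derivative_def)
  have I: "open {0::real<..}" "t \<in> {0<..}" using t by auto
  have w': "has_L2_derivative w (\<lambda>x. utt t x - \<sigma> * uxxt t x) t"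
    unfolding w_def[abs_def]
    by (rule has_L2_derivative_diff_cmult[OF I]) (use profile_L2 ut.has_L2_derivative[OF t] C1_L2_has_derivative[OF uxx_C1 t] in auto)
  have dV: "(V has_real_derivative (L2_inner (ut t) (utt t) + c\<^sup>2 * L2_inner (ux t) (uxt t) + a * \<sigma> * dt u (t, 1) * dt (dt u) (t, 1)
    + b / lam * L2_inner (curry \<theta> t) (\<theta>t t) + \<epsilon> * L2_inner (w t) (\<lambda>x. utt t x - \<sigma> * uxxt t x))) (at t)"
  proof -
    have L2': "ut s \<in> L2" "ux s \<in> L2" "curry \<theta> s \<in> L2" "w s \<in> L2" if "s \<in> {0<..}" for s
      using profile_L2[of s] that by auto
    note d = has_L2_derivative_norm_square[OF I L2'(1) ut.has_L2_derivative[OF t]]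
        has_L2_derivative_norm_square[OF I L2'(2) ux.has_L2_derivative[OF t]]
        has_L2_derivative_norm_square[OF I L2'(3) C1_L2_has_derivative[OF \<theta>_C1 t]]
        has_L2_derivative_norm_square[OF I L2'(4) w']
        ut.dt_at[OF t, of 1, simplified]
    show ?thesis
      unfolding V_def by (rule derivative_eq_intros refl d | assumption)+ simp
  qed
  \<comment> \<open>The right-hand side of the wave equation without the Kelvin-Voigt term, which equals the time derivative of \<open>w\<close>.\<close>
  define R where "R = (\<lambda>x. c\<^sup>2 * uxx t x - \<mu> * ut t x - b * \<theta>x t x + curry f t x)"
  have R: "R \<in> L2" unfolding R_def by (intro L2_intros L2 \<theta>.L2) (use t in auto)
  have R_inner: "L2_inner y R = c\<^sup>2 * L2_inner y (uxx t) - \<mu> * L2_inner y (ut t) - b * L2_inner y (\<theta>x t) + L2_inner y (curry f t)"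
    if y: "y \<in> L2" for y
    unfolding R_def using t y L2 \<theta>.L2 by (simp add: L2_inner_add_right L2_inner_diff_right L2_inner_cmult_right L2_intros)
  have utt_ae: "AE x in unit_measure. utt t x = R x + \<sigma> * uxxt t x"
    using wave[OF t] by eventually_elim (simp add: R_def curry_conv)
  have i1: "L2_inner (ut t) (utt t) = L2_inner (ut t) R + \<sigma> * L2_inner (ut t) (uxxt t)"
    using L2_inner_cong_AE[OF utt_ae, of "ut t"] t L2 R uxxt by (simp add: L2_inner_add_right L2_inner_cmult_right L2_intros)
  have i2: "L2_inner (w t) (\<lambda>x. utt t x - \<sigma> * uxxt t x) = L2_inner (w t) R"
  proof (rule L2_inner_cong_AE)
    show "AE x in unit_measure. utt t x - \<sigma> * uxxt t x = R x" using utt_ae by eventually_elim simp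
  qed (use t L2 R uxxt in \<open>auto intro!: L2_intros\<close>)
  have i3: "L2_inner (curry \<theta> t) (\<theta>t t) = k * L2_inner (curry \<theta> t) (\<theta>xx t) - lam * L2_inner (curry \<theta> t) (uxt t)"
  proof -
    have "AE x in unit_measure. \<theta>t t x = k * \<theta>xx t x - lam * uxt t x"
      using heat[OF t] by (simp add: curry_conv)
    from L2_inner_cong_AE[OF this, of "curry \<theta> t"] show ?thesis
      using t L2 \<theta>.L2 \<theta>t by (simp add: L2_inner_diff_right L2_inner_cmult_right L2_intros)
  qed
  have A: "L2_inner (ut t) (uxx t) = - a * (dt u (t, 1))\<^sup>2 - L2_inner (ux t) (uxt t)"
    using ut_uxx_by_parts[OF t t] ux1[OF t] by (simp add: L2_inner_commute[of "ut t"] power2_eq_square)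
  have B: "L2_inner (ut t) (uxxt t) = - a * dt (dt u) (t, 1) * dt u (t, 1) - L2_inner (uxt t) (uxt t)"
    using ut_uxxt_by_parts[OF t] boundary_velocity(2)[OF t] by simp
  have C: "L2_inner (ut t) (\<theta>x t) = - L2_inner (curry \<theta> t) (uxt t)"
    by (rule \<theta>.by_parts) (use t profile_continuous[of t] dt_within[OF u0 t] in \<open>auto simp: curry_def\<close>)
  have w_uxx: "c\<^sup>2 * L2_inner (w t) (uxx t) = \<kappa> * (L2_inner (w t) (ut t) - L2_inner (w t) (w t))"
  proof -
    have "w t = (\<lambda>x. ut t x - \<sigma> * uxx t x)" by (simp add: w_def[abs_def])
    then have "L2_inner (w t) (w t) = L2_inner (w t) (ut t) - \<sigma> * L2_inner (w t) (uxx t)"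
      using L2_inner_diff_right[of "ut t" "\<lambda>x. \<sigma> * uxx t x" "w t"] L2 t by (simp add: L2_inner_cmult_right L2_intros)
    moreover have "c\<^sup>2 = \<kappa> * \<sigma>" using pos by (simp add: \<kappa>_def)
    ultimately show ?thesis by (simp add: mult.assoc)
  qed
  show ?thesis
  proof (rule DERIV_cong[OF dV])
    have lam: "b / lam * (k * y - lam * z) = b * k / lam * y - b * z" for y z
      using pos by (simp add: field_simps)
    show "L2_inner (ut t) (utt t) + c\<^sup>2 * L2_inner (ux t) (uxt t) + a * \<sigma> * dt u (t, 1) * dt (dt u) (t, 1)
    + b / lam * L2_inner (curry \<theta> t) (\<theta>t t) + \<epsilon> * L2_inner (w t) (\<lambda>x. utt t x - \<sigma> * uxxt t x) =
      - a * c\<^sup>2 * (dt u (t, 1))\<^sup>2 - \<sigma> * L2_inner (uxt t) (uxt t) - \<mu> * L2_inner (ut t) (ut t)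
       - b * k / lam * L2_inner (\<theta>x t) (\<theta>x t) + L2_inner (ut t) (curry f t)
       + \<epsilon> * (- \<kappa> * L2_inner (w t) (w t) + (\<kappa> - \<mu>) * L2_inner (w t) (ut t)
           - b * L2_inner (w t) (\<theta>x t) + L2_inner (w t) (curry f t))"
      using t L2 unfolding i1 i2 i3 lam
      by (simp add: R_inner w_uxx A B C \<theta>.inner_second_deriv) (simp add: algebra_simps)
  qed
qed

end

section \<open>Quadratic inequalities\<close>

lemma L2_weighted_Young:
  assumes "f \<in> L2" "g \<in> L2" "0 < \<delta>"
  shows "r * L2_inner f g \<le> \<delta> * L2_inner f f + r\<^sup>2 / (4 * \<delta>) * L2_inner g g"
  using L2_Young[OF assms(1) L2_cmult[OF assms(2), of r] assms(3)]
  by (simp add: L2_inner_cmult_right L2_inner_cmult_left power2_eq_square mult.assoc)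

lemma L2_inner_diff_self_le:
  assumes "f \<in> L2" "g \<in> L2"
  shows "L2_inner (\<lambda>x. f x - g x) (\<lambda>x. f x - g x) \<le> 2 * L2_inner f f + 2 * L2_inner g g"
proof -
  have "L2_inner (\<lambda>x. f x - g x) (\<lambda>x. f x - g x) = L2_inner f f + (- 2) * L2_inner f g + L2_inner g g"
    using assms by (simp add: L2_inner_linear L2_intros L2_inner_commute[of g f])
  moreover have "(- 2) * L2_inner f g \<le> 1 * L2_inner f f + (- 2)\<^sup>2 / (4 * 1) * L2_inner g g"
    by (rule L2_weighted_Young[OF assms]) simp
  ultimately show ?thesis by simp
qed

section \<open>Dissipation and stability\<close>

context thermoelastic_solution
begin

lemma w_uxx_bounds:
  assumes "0 \<le> t"
  shows "L2_inner (w t) (w t) \<le> 2 * L2_inner (ut t) (ut t) + 2 * \<sigma>\<^sup>2 * L2_inner (uxx t) (uxx t)"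
    and "L2_inner (uxx t) (uxx t) \<le> 2 / \<sigma>\<^sup>2 * L2_inner (ut t) (ut t) + 2 / \<sigma>\<^sup>2 * L2_inner (w t) (w t)"
proof -
  note L2 = profile_L2[OF assms]
  have sq: "L2_inner (\<lambda>x. \<sigma> * uxx t x) (\<lambda>x. \<sigma> * uxx t x) = \<sigma>\<^sup>2 * L2_inner (uxx t) (uxx t)"
    by (simp only: L2_inner_cmult_left L2_inner_cmult_right power2_eq_square mult.assoc)
  have w: "w t = (\<lambda>x. ut t x - \<sigma> * uxx t x)" by (simp add: w_def[abs_def])
  show "L2_inner (w t) (w t) \<le> 2 * L2_inner (ut t) (ut t) + 2 * \<sigma>\<^sup>2 * L2_inner (uxx t) (uxx t)"
    using L2_inner_diff_self_le[OF L2(1) L2_cmult[OF L2(3), of \<sigma>]] sq by (simp only: w mult.assoc)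
  have "(\<lambda>x. \<sigma> * uxx t x) = (\<lambda>x. ut t x - w t x)" by (simp add: w_def)
  then have "\<sigma>\<^sup>2 * L2_inner (uxx t) (uxx t) \<le> 2 * L2_inner (ut t) (ut t) + 2 * L2_inner (w t) (w t)"
    using L2_inner_diff_self_le[OF L2(1) L2(7)] sq by simp
  then show "L2_inner (uxx t) (uxx t) \<le> 2 / \<sigma>\<^sup>2 * L2_inner (ut t) (ut t) + 2 / \<sigma>\<^sup>2 * L2_inner (w t) (w t)"
    using pos by (simp add: field_simps)
qed

text \<open>The three cross terms that involve \<open>w\<close> are each split by Young's inequality with weight \<open>\<kappa> / 6\<close>, which uses
  up half of the decay of \<open>w\<close>.\<close>

lemma V_dissipation:
  assumes t: "0 < t"
  shows "\<exists>d. (V has_real_derivative d) (at t) \<and> d \<le> - (m / M) * V t + K * L2_inner (curry f t) (curry f t)"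
proof -
  interpret \<theta>: H2_Dirichlet "curry \<theta> t" by (rule \<theta>_Dirichlet[OF t])
  have t0: "0 \<le> t" using t by simp
  note L2 = profile_L2[OF t0]
  define p X Y W F v e r y
    where "p = (dt u (t, 1))\<^sup>2" and "X = L2_inner (uxt t) (uxt t)" and "Y = L2_inner (\<theta>x t) (\<theta>x t)"
      and "W = L2_inner (w t) (w t)" and "F = L2_inner (curry f t) (curry f t)"
      and "v = L2_inner (ut t) (ut t)" and "e = L2_inner (ux t) (ux t)" and "r = L2_inner (uxx t) (uxx t)"
      and "y = L2_inner (curry \<theta> t) (curry \<theta> t)"
  note defs = p_def X_def Y_def W_def F_def v_def e_def r_def y_def
  have nn: "0 \<le> p" "0 \<le> X" "0 \<le> Y" "0 \<le> W" "0 \<le> F" "0 \<le> v" "0 \<le> e" "0 \<le> r" "0 \<le> y"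
    unfolding defs by (simp_all add: L2_inner_self_nonneg)
  have vX: "v \<le> X" unfolding defs by (rule velocity_Poincare[OF t])
  have yY: "y \<le> Y" unfolding defs by (rule \<theta>.Poincare)
  have er: "e \<le> 2 * a\<^sup>2 * p + 2 * r" unfolding defs by (rule strain_bound[OF t])
  have rW: "r \<le> 2 / \<sigma>\<^sup>2 * v + 2 / \<sigma>\<^sup>2 * W" unfolding defs by (rule w_uxx_bounds(2)[OF t0])
  define d where "d = - a * c\<^sup>2 * p - \<sigma> * X - \<mu> * v - b * k / lam * Y + L2_inner (ut t) (curry f t)
       + \<epsilon> * (- \<kappa> * W + (\<kappa> - \<mu>) * L2_inner (w t) (ut t)
           - b * L2_inner (w t) (\<theta>x t) + L2_inner (w t) (curry f t))"
  have dV: "(V has_real_derivative d) (at t)"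
    using V_derivative[OF t] unfolding d_def defs .
  define \<delta> where "\<delta> = 3 / (2 * \<kappa>)"
  have y1: "L2_inner (ut t) (curry f t) \<le> \<sigma> / 4 * v + 1 / \<sigma> * F"
    using L2_Young[OF L2(1) L2(8), of "\<sigma> / 4"] pos by (simp add: defs)
  have \<delta>: "z / (4 * (\<kappa> / 6)) = \<delta> * z" for z using \<kappa>_pos by (simp add: \<delta>_def)
  have y2: "(\<kappa> - \<mu>) * L2_inner (w t) (ut t) \<le> \<kappa> / 6 * W + \<delta> * (\<kappa> - \<mu>)\<^sup>2 * v"
    using L2_weighted_Young[OF L2(7) L2(1), of "\<kappa> / 6" "\<kappa> - \<mu>"] \<kappa>_pos unfolding \<delta> defs by simp
  have y3: "(- b) * L2_inner (w t) (\<theta>x t) \<le> \<kappa> / 6 * W + \<delta> * b\<^sup>2 * Y"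
    using L2_weighted_Young[OF L2(7) \<theta>.L2(2), of "\<kappa> / 6" "- b"] \<kappa>_pos unfolding \<delta> defs by simp
  have y4: "1 * L2_inner (w t) (curry f t) \<le> \<kappa> / 6 * W + \<delta> * F"
    using L2_weighted_Young[OF L2(7) L2(8), of "\<kappa> / 6" 1] \<kappa>_pos unfolding \<delta> defs by simp
  have "d \<le> - a * c\<^sup>2 * p - \<sigma> / 2 * X - b * k / (2 * lam) * Y - \<epsilon> * \<kappa> / 2 * W + K * F"
  proof -
    have "\<epsilon> * (- \<kappa> * W + (\<kappa> - \<mu>) * L2_inner (w t) (ut t) - b * L2_inner (w t) (\<theta>x t) + L2_inner (w t) (curry f t))
        \<le> \<epsilon> * (- \<kappa> / 2 * W + \<delta> * (\<kappa> - \<mu>)\<^sup>2 * v + \<delta> * b\<^sup>2 * Y + \<delta> * F)"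
      using y2 y3 y4 \<epsilon>_pos by (intro mult_left_mono) auto
    also have "\<dots> = - \<epsilon> * \<kappa> / 2 * W + \<epsilon> * \<delta> * (\<kappa> - \<mu>)\<^sup>2 * v + \<epsilon> * \<delta> * b\<^sup>2 * Y + \<epsilon> * \<delta> * F"
      by (simp add: algebra_simps)
    also have "\<dots> \<le> - \<epsilon> * \<kappa> / 2 * W + \<sigma> / 4 * v + b * k / (2 * lam) * Y + \<epsilon> * \<delta> * F"
      using \<epsilon>_small nn unfolding \<delta>_def by (intro add_mono mult_right_mono order_refl) auto
    finally have "d \<le> - a * c\<^sup>2 * p - \<sigma> * X - \<mu> * v - b * k / lam * Y + (\<sigma> / 4 * v + 1 / \<sigma> * F)
        + (- \<epsilon> * \<kappa> / 2 * W + \<sigma> / 4 * v + b * k / (2 * lam) * Y + \<epsilon> * \<delta> * F)"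
      unfolding d_def using y1 by linarith
    moreover have "b * k / lam * Y = b * k / (2 * lam) * Y + b * k / (2 * lam) * Y"
      by (simp add: field_simps)
    moreover have "K * F = 1 / \<sigma> * F + \<epsilon> * \<delta> * F" by (simp add: K_def \<delta>_def algebra_simps)
    moreover have "\<sigma> * v \<le> \<sigma> * X" "0 \<le> \<mu> * v" using vX pos nn by auto
    ultimately show ?thesis by (simp add: algebra_simps)
  qed
  moreover have "m * (p + X + Y + W) \<le> a * c\<^sup>2 * p + \<sigma> / 2 * X + b * k / (2 * lam) * Y + \<epsilon> * \<kappa> / 2 * W"
    unfolding distrib_left using nn by (intro add_mono mult_right_mono) (auto simp: m_def)
  moreover have "V t \<le> M * (p + X + Y + W)"
  proof -
    have V: "V t = 1 / 2 * v + c\<^sup>2 / 2 * e + a * \<sigma> / 2 * p + b / (2 * lam) * y + \<epsilon> / 2 * W"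
      by (simp add: V_def defs)
    have "e \<le> 2 * a\<^sup>2 * p + 2 * (2 / \<sigma>\<^sup>2 * X + 2 / \<sigma>\<^sup>2 * W)"
      using er rW mult_left_mono[OF vX, of "2 / \<sigma>\<^sup>2"] by simp
    then have "c\<^sup>2 / 2 * e \<le> c\<^sup>2 / 2 * (2 * a\<^sup>2 * p + 2 * (2 / \<sigma>\<^sup>2 * X + 2 / \<sigma>\<^sup>2 * W))"
      by (rule mult_left_mono) simp
    also have "\<dots> = a\<^sup>2 * c\<^sup>2 * p + 2 * c\<^sup>2 / \<sigma>\<^sup>2 * X + 2 * c\<^sup>2 / \<sigma>\<^sup>2 * W"
      by (simp add: algebra_simps)
    finally have "V t \<le> 1 / 2 * X + (a\<^sup>2 * c\<^sup>2 * p + 2 * c\<^sup>2 / \<sigma>\<^sup>2 * X + 2 * c\<^sup>2 / \<sigma>\<^sup>2 * W)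
        + a * \<sigma> / 2 * p + b / (2 * lam) * Y + \<epsilon> / 2 * W"
      unfolding V using vX mult_left_mono[OF yY, of "b / (2 * lam)"] pos by simp
    also have "\<dots> = (a\<^sup>2 * c\<^sup>2 + a * \<sigma> / 2) * p + (1 / 2 + 2 * c\<^sup>2 / \<sigma>\<^sup>2) * X + b / (2 * lam) * Y
        + (2 * c\<^sup>2 / \<sigma>\<^sup>2 + \<epsilon> / 2) * W"
      by (simp only: distrib_right)
    also have "\<dots> \<le> M * p + M * X + M * Y + M * W"
    proof -
      have "0 \<le> a\<^sup>2 * c\<^sup>2" "0 \<le> 2 * c\<^sup>2 / \<sigma>\<^sup>2" "0 \<le> a * \<sigma> / 2" "0 \<le> b / (2 * lam)" "0 \<le> \<epsilon> / 2"
        using pos \<epsilon>_pos by auto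
      then show ?thesis using nn by (intro add_mono mult_right_mono) (auto simp: M_def)
    qed
    finally show ?thesis by (simp add: distrib_left)
  qed
  then have "m / M * V t \<le> m * (p + X + Y + W)"
    using constants_pos mult_left_mono[of "V t" "M * (p + X + Y + W)" "m / M"] by simp
  ultimately have "d \<le> - (m / M) * V t + K * F" by simp
  then show ?thesis using dV unfolding F_def by blast
qed

lemma V_continuous: "continuous_on {0..} V"
proof -
  have "continuous_on strip (\<lambda>z. dt u z - \<sigma> * dx (dx u) z)"
    by (intro continuous_intros ut.continuous ux.continuous)
  from continuous_on_L2_inner_strip[OF this]
  have "continuous_on {0..} (\<lambda>t. L2_inner (w t) (w t))"
    by (simp add: w_def[abs_def] curry_def)
  moreover have "continuous_on {0..} (\<lambda>t. dt u (t, 1))"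
    by (rule continuous_on_strip_trace[OF ut.continuous(1)]) simp
  ultimately show ?thesis
    unfolding V_def[abs_def]
    by (intro continuous_intros continuous_on_L2_inner_strip ut.continuous ux.continuous \<theta>_cont)
qed

lemma state_norm_square:
  "(state_norm u \<theta> t)\<^sup>2 = L2_inner (ut t) (ut t) + L2_inner (ux t) (ux t) + L2_inner (uxx t) (uxx t)
      + (dt u (t, 1))\<^sup>2 + L2_inner (curry \<theta> t) (curry \<theta> t)"
  by (simp add: state_norm_def L2_norm_square L2_inner_self_nonneg add_nonneg_nonneg)

lemma state_norm_V_equivalent:
  assumes "0 \<le> t"
  shows "(state_norm u \<theta> t)\<^sup>2 \<le> C1 * V t" "V t \<le> C2 * (state_norm u \<theta> t)\<^sup>2"
proof -
  define p W v e r y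
    where "p = (dt u (t, 1))\<^sup>2" and "W = L2_inner (w t) (w t)"
      and "v = L2_inner (ut t) (ut t)" and "e = L2_inner (ux t) (ux t)" and "r = L2_inner (uxx t) (uxx t)"
      and "y = L2_inner (curry \<theta> t) (curry \<theta> t)"
  note defs = p_def W_def v_def e_def r_def y_def
  have nn: "0 \<le> p" "0 \<le> W" "0 \<le> v" "0 \<le> e" "0 \<le> r" "0 \<le> y"
    unfolding defs by (simp_all add: L2_inner_self_nonneg)
  have S: "(state_norm u \<theta> t)\<^sup>2 = v + e + r + p + y"
    unfolding state_norm_square defs ..
  have V: "V t = 1 / 2 * v + c\<^sup>2 / 2 * e + a * \<sigma> / 2 * p + b / (2 * lam) * y + \<epsilon> / 2 * W"
    by (simp add: V_def defs)
  have Wr: "W \<le> 2 * v + 2 * \<sigma>\<^sup>2 * r" and rW: "r \<le> 2 / \<sigma>\<^sup>2 * v + 2 / \<sigma>\<^sup>2 * W"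
    unfolding defs by (rule w_uxx_bounds[OF assms])+
  have coeff: "0 \<le> c\<^sup>2 / 2" "0 \<le> a * \<sigma> / 2" "0 \<le> b / (2 * lam)" "0 \<le> \<epsilon>" "0 \<le> \<epsilon> * \<sigma>\<^sup>2"
    using pos \<epsilon>_pos by auto
  have terms: "0 \<le> c\<^sup>2 / 2 * e" "0 \<le> a * \<sigma> / 2 * p" "0 \<le> b / (2 * lam) * y" "0 \<le> \<epsilon> / 2 * W"
    using coeff nn by (auto intro!: mult_nonneg_nonneg simp del: times_divide_eq_left)
  have parts: "v \<le> 2 * V t" "e \<le> 2 / c\<^sup>2 * V t" "p \<le> 2 / (a * \<sigma>) * V t" "y \<le> 2 * lam / b * V t" "W \<le> 2 / \<epsilon> * V t"
  proof -
    have "1 / 2 * v \<le> V t" using terms unfolding V by linarith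
    then show "v \<le> 2 * V t" by simp
    have le: "c\<^sup>2 / 2 * e \<le> V t" "a * \<sigma> / 2 * p \<le> V t" "b / (2 * lam) * y \<le> V t" "\<epsilon> / 2 * W \<le> V t"
      using terms nn(3) unfolding V by linarith+
    show "e \<le> 2 / c\<^sup>2 * V t" "p \<le> 2 / (a * \<sigma>) * V t" "y \<le> 2 * lam / b * V t" "W \<le> 2 / \<epsilon> * V t"
      using le pos \<epsilon>_pos by (simp_all add: field_simps)
  qed
  have "r \<le> 2 / \<sigma>\<^sup>2 * (2 * V t) + 2 / \<sigma>\<^sup>2 * (2 / \<epsilon> * V t)"
  proof -
    have "0 \<le> 2 / \<sigma>\<^sup>2" by simp
    from mult_left_mono[OF parts(1) this] mult_left_mono[OF parts(5) this] rW show ?thesis by linarith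
  qed
  also have "\<dots> = (4 + 4 / \<epsilon>) / \<sigma>\<^sup>2 * V t"
    by (simp add: add_divide_distrib distrib_right)
  finally have "(state_norm u \<theta> t)\<^sup>2 \<le> 2 * V t + 2 / c\<^sup>2 * V t + (4 + 4 / \<epsilon>) / \<sigma>\<^sup>2 * V t + 2 / (a * \<sigma>) * V t + 2 * lam / b * V t"
    unfolding S using parts by linarith
  also have "\<dots> = C1 * V t" unfolding C1_def distrib_right by linarith
  finally show "(state_norm u \<theta> t)\<^sup>2 \<le> C1 * V t" .
  have "V t \<le> 1 / 2 * v + c\<^sup>2 / 2 * e + a * \<sigma> / 2 * p + b / (2 * lam) * y + \<epsilon> / 2 * (2 * v + 2 * \<sigma>\<^sup>2 * r)"
    unfolding V using mult_left_mono[OF Wr, of "\<epsilon> / 2"] \<epsilon>_pos by simp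
  also have "\<dots> = (1 / 2 + \<epsilon>) * v + c\<^sup>2 / 2 * e + \<epsilon> * \<sigma>\<^sup>2 * r + a * \<sigma> / 2 * p + b / (2 * lam) * y"
    by (simp add: algebra_simps)
  also have "\<dots> \<le> C2 * v + C2 * e + C2 * r + C2 * p + C2 * y"
    using nn coeff by (intro add_mono mult_right_mono) (auto simp: C2_def)
  finally show "V t \<le> C2 * (state_norm u \<theta> t)\<^sup>2"
    unfolding S by (simp add: distrib_left)
qed

text \<open>Continuity of \<open>f\<close> into \<open>L\<^sup>2\<close> makes the set bounded, without which \<open>SUP\<close> would be meaningless.\<close>

lemma L2_norm_f_le_SUP:
  assumes "0 \<le> s" "s \<le> t"
  shows "L2_norm (curry f s) \<le> (SUP s\<in>{0..t}. L2_norm (curry f s))"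
proof (rule cSUP_upper)
  have "continuous_on {0..} (\<lambda>s. L2_norm (curry f s))"
    unfolding continuous_on_def
  proof
    fix r :: real assume r: "r \<in> {0..}"
    show "((\<lambda>s. L2_norm (curry f s)) \<longlongrightarrow> L2_norm (curry f r)) (at r within {0..})"
    proof (rule tendsto_L2_norm)
      show "\<forall>\<^sub>F s in at r within {0..}. curry f s \<in> L2"
        using profile_L2(8) by (simp add: eventually_at_filter)
    qed (use f r in \<open>auto simp: C0_L2_def\<close>)
  qed
  then have "continuous_on {0..t} (\<lambda>s. L2_norm (curry f s))"
    by (rule continuous_on_subset) auto
  then have "bounded ((\<lambda>s. L2_norm (curry f s)) ` {0..t})"
    by (intro compact_imp_bounded compact_continuous_image compact_Icc)
  then show "bdd_above ((\<lambda>s. L2_norm (curry f s)) ` {0..t})"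
    by (rule bounded_imp_bdd_above)
qed (use assms in auto)

text \<open>Gronwall's lemma bounds the square of the state norm by a sum of two squares, and the square root of
  such a sum is at most the sum of the roots; this halves the rate \<open>m / M\<close>.\<close>

theorem input_to_state_stability:
  assumes t: "0 \<le> t"
  shows "state_norm u \<theta> t \<le> sqrt (C1 * C2) * exp (- (m / (2 * M)) * t) * state_norm u \<theta> 0
      + sqrt (C1 * (K * M / m)) * (SUP s\<in>{0..t}. L2_norm (curry f s))"
proof -
  define B where "B = (SUP s\<in>{0..t}. L2_norm (curry f s))"
  define r where "r = m / M"
  have r: "0 < r" using constants_pos by (simp add: r_def)
  have B0: "0 \<le> B"
    using L2_norm_f_le_SUP[of 0 t] t L2_norm_nonneg[of "curry f 0"] unfolding B_def by linarith
  have sn: "0 \<le> state_norm u \<theta> 0" by (simp add: state_norm_def)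
  have "V t \<le> exp (- r * t) * V 0 + K * B\<^sup>2 / r * (1 - exp (- r * t))"
  proof (rule Gronwall_decay[OF r t])
    show "continuous_on {0..t} V" by (rule continuous_on_subset[OF V_continuous]) auto
    fix s assume s: "0 < s" "s < t"
    then obtain d where d: "(V has_real_derivative d) (at s)"
      "d \<le> - r * V s + K * L2_inner (curry f s) (curry f s)"
      using V_dissipation unfolding r_def by blast
    have "L2_inner (curry f s) (curry f s) \<le> B\<^sup>2"
      unfolding L2_norm_square[symmetric] B_def
      by (rule power_mono[OF L2_norm_f_le_SUP L2_norm_nonneg]) (use s in auto)
    then have "K * L2_inner (curry f s) (curry f s) \<le> K * B\<^sup>2"
      using constants_pos by (intro mult_left_mono) auto
    then show "\<exists>d. (V has_real_derivative d) (at s) \<and> d \<le> - r * V s + K * B\<^sup>2"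
      using d by (intro exI[of _ d]) auto
  qed
  also have "\<dots> \<le> exp (- r * t) * V 0 + K * B\<^sup>2 / r"
    using constants_pos r by (intro add_left_mono mult_left_le) auto
  also have "\<dots> \<le> exp (- r * t) * (C2 * (state_norm u \<theta> 0)\<^sup>2) + K * B\<^sup>2 / r"
    by (intro add_right_mono mult_left_mono state_norm_V_equivalent) auto
  finally have "(state_norm u \<theta> t)\<^sup>2 \<le> C1 * (exp (- r * t) * (C2 * (state_norm u \<theta> 0)\<^sup>2) + K * B\<^sup>2 / r)"
    using state_norm_V_equivalent(1)[OF t] constants_pos(4)
    by (meson mult_left_mono less_imp_le order_trans)
  also have "\<dots> = (sqrt (C1 * C2) * exp (- (r / 2) * t) * state_norm u \<theta> 0)\<^sup>2 + (sqrt (C1 * (K / r)) * B)\<^sup>2"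
  proof -
    have "(exp (- (r / 2) * t))\<^sup>2 = exp (- r * t)"
      by (simp add: power2_eq_square flip: exp_add)
    then show ?thesis using constants_pos r
      by (simp add: power_mult_distrib distrib_left)
  qed
  also have "\<dots> \<le> (sqrt (C1 * C2) * exp (- (r / 2) * t) * state_norm u \<theta> 0 + sqrt (C1 * (K / r)) * B)\<^sup>2"
    using constants_pos r B0 sn by (simp add: power2_sum)
  finally have "state_norm u \<theta> t \<le> sqrt (C1 * C2) * exp (- (r / 2) * t) * state_norm u \<theta> 0 + sqrt (C1 * (K / r)) * B"
    by (rule power2_le_imp_le) (use constants_pos r B0 sn in auto)
  then show ?thesis by (simp add: r_def B_def mult.commute)
qed

end

theorem theorem3:
  fixes a c \<mu> \<sigma> b k lam :: real
  assumes "a > 0" and "c > 0" and "\<mu> \<ge> 0" and "\<sigma> > 0" and "b > 0" and "k > 0" and "lam > 0"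
  shows "\<exists>\<omega> G \<gamma> :: real. \<omega> > 0 \<and> G > 0 \<and> \<gamma> > 0 \<and>
    (\<forall>f u \<theta> :: real \<times> real \<Rightarrow> real.
       curry f \<in> C0_L2 {0..} \<and> f \<in> C_class 0 ({0<..} \<times> {0<..<1}) \<and>
       u \<in> C_class 2 strip \<and>
       \<theta> \<in> C_class 0 strip \<and> curry \<theta> \<in> C1_L2 {0<..} \<and>
       curry (dx (dx u)) \<in> C1_L2 {0<..} \<and>
       (\<forall>t>0. curry \<theta> t \<in> H2 \<and> curry (dt u) t \<in> H2) \<and>
       (\<forall>t>0. AE x in unit_measure.
          dt (dt u) (t, x) = c\<^sup>2 * dx (dx u) (t, x) + \<sigma> * L2_deriv (curry (dx (dx u))) t x
            - \<mu> * dt u (t, x) - b * weak_deriv 1 (curry \<theta> t) x + f (t, x)) \<and>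
       (\<forall>t>0. AE x in unit_measure.
          L2_deriv (curry \<theta>) t x = k * weak_deriv 2 (curry \<theta> t) x - lam * dt (dx u) (t, x)) \<and>
       (\<forall>t>0. u (t, 0) = 0) \<and>
       (\<forall>t>0. dx u (t, 1) = - a * dt u (t, 1)) \<and>
       (\<forall>t>0. \<theta> (t, 0) = 0 \<and> \<theta> (t, 1) = 0) \<longrightarrow>
       (\<forall>t\<ge>0. state_norm u \<theta> t
          \<le> G * exp (- \<omega> * t) * state_norm u \<theta> 0 + \<gamma> * (SUP s\<in>{0..t}. L2_norm (curry f s))))"
proof -
  interpret thermoelastic_coefficients a c \<mu> \<sigma> b k lam
    using assms by unfold_locales
  show ?thesis
  proof (rule exI[of _ "m / (2 * M)"], rule exI[of _ "sqrt (C1 * C2)"], rule exI[of _ "sqrt (C1 * (K * M / m))"],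
      intro conjI allI impI)
    fix f u \<theta> :: "real \<times> real \<Rightarrow> real" and t :: real
    assume sol: "curry f \<in> C0_L2 {0..} \<and> f \<in> C_class 0 ({0<..} \<times> {0<..<1}) \<and>
       u \<in> C_class 2 strip \<and>
       \<theta> \<in> C_class 0 strip \<and> curry \<theta> \<in> C1_L2 {0<..} \<and>
       curry (dx (dx u)) \<in> C1_L2 {0<..} \<and>
       (\<forall>t>0. curry \<theta> t \<in> H2 \<and> curry (dt u) t \<in> H2) \<and>
       (\<forall>t>0. AE x in unit_measure.
          dt (dt u) (t, x) = c\<^sup>2 * dx (dx u) (t, x) + \<sigma> * L2_deriv (curry (dx (dx u))) t x
            - \<mu> * dt u (t, x) - b * weak_deriv 1 (curry \<theta> t) x + f (t, x)) \<and>
       (\<forall>t>0. AE x in unit_measure.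
          L2_deriv (curry \<theta>) t x = k * weak_deriv 2 (curry \<theta> t) x - lam * dt (dx u) (t, x)) \<and>
       (\<forall>t>0. u (t, 0) = 0) \<and>
       (\<forall>t>0. dx u (t, 1) = - a * dt u (t, 1)) \<and>
       (\<forall>t>0. \<theta> (t, 0) = 0 \<and> \<theta> (t, 1) = 0)"
    assume t: "0 \<le> t"
    have "\<theta> \<in> C_class 0 strip" using sol by blast
    then have "continuous_on strip \<theta>" by simp
    with sol interpret thermoelastic_solution a c \<mu> \<sigma> b k lam u f \<theta>
      by unfold_locales blast+
    show "state_norm u \<theta> t \<le> sqrt (C1 * C2) * exp (- (m / (2 * M)) * t) * state_norm u \<theta> 0
        + sqrt (C1 * (K * M / m)) * (SUP s\<in>{0..t}. L2_norm (curry f s))"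
      by (rule input_to_state_stability[OF t])
  qed (use constants_pos in auto)
qed

end
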